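(* Let $K$ be a field, let $n\geq 1$, let $2\leq d_1\leq \dots\leq d_n$ be integers, and let $H^{[n]}$ be the Hilbert function of $K[x_1,\dots,x_n]/I$, where $I$ is generated by a regular sequence of $n$ forms of degrees $d_1,\dots,d_n$ in $K[x_1,\dots,x_n]$. Then $H^{[n]}$ admits an almost revlex ideal, i.e. there exists an almost revlex ideal $J\subset K[x_1,\dots,x_n]$ such that the Hilbert function of $K[x_1,\dots,x_n]/J$ is $H^{[n]}$.
   Context: $R=K[x_1,\dots,x_n]$ has its standard grading and is endowed with the degree reverse lexicographic term order $\succ$ with $x_1\succ\dots\succ x_n$. $\mathbb T$ is the set of terms (monomials with coefficient $1$) of $R$ and $\mathbb T_t$ the set of terms of degree $t$. For a monomial ideal $J$, $B_J$ is its set of minimal monomial generators. The Hilbert function of $R/I$ ($I$ homogeneous) is $H_{R/I}(t)=\dim_K (R/I)_t$. The function $H^{[n]}$ depends only on $d_1,\dots,d_n$. A monomial ideal $J\subset R$ is an almost reverse lexicographic ideal (almost revlex ideal) if, for every $\tau\in B_J$ and every $\tau'\in\mathbb T_{\deg(\tau)}$, $\tau'\succ\tau$ implies $\tau'\in J$. *)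

theory Defs
  imports
    "HOL-Library.Poly_Mapping"
    "HOL-Algebra.Embedded_Algebras"
    "HOL-Algebra.QuotRing"
begin

type_synonym expo = "nat \<Rightarrow>\<^sub>0 nat"
type_synonym 'a mpoly = "expo \<Rightarrow>\<^sub>0 'a"

text \<open>
  The terms of \<open>K[x\<^sub>1, \<dots>, x\<^sub>n]\<close> are identified with their exponent vectors, supported
  on the variable indices \<open>{1..n}\<close>. The polynomial ring is the subring of
  \<open>(nat \<Rightarrow>\<^sub>0 nat) \<Rightarrow>\<^sub>0 K\<close> of all polynomials involving only these terms.
\<close>

definition pp_terms :: "nat \<Rightarrow> expo set" where
  "pp_terms n = {u. Poly_Mapping.keys u \<subseteq> {1..n}}"

definition pp_deg :: "expo \<Rightarrow> nat" where
  "pp_deg u = (\<Sum>i\<in>Poly_Mapping.keys u. Poly_Mapping.lookup u i)"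

definition mono_of :: "expo \<Rightarrow> 'a::field mpoly" where
  "mono_of u = Poly_Mapping.single u 1"

definition mpoly_ring :: "nat \<Rightarrow> 'a::field mpoly ring" where
  "mpoly_ring n =
    \<lparr>carrier = {p. Poly_Mapping.keys p \<subseteq> pp_terms n}, mult = (*), one = 1, zero = 0, add = (+)\<rparr>"

lemma cring_mpoly_ring: "cring (mpoly_ring n :: 'a::field mpoly ring)"
proof (rule cringI)
  show "abelian_group (mpoly_ring n :: 'a mpoly ring)"
  proof (rule abelian_groupI)
    fix x :: "'a mpoly" assume "x \<in> carrier (mpoly_ring n)"
    then show "\<exists>y\<in>carrier (mpoly_ring n). y \<oplus>\<^bsub>mpoly_ring n\<^esub> x = \<zero>\<^bsub>mpoly_ring n\<^esub>"
      by (intro bexI[of _ "- x"]) (auto simp: mpoly_ring_def)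
  qed (use Poly_Mapping.keys_add in \<open>fastforce simp: mpoly_ring_def add_ac\<close>)+
  show "Group.comm_monoid (mpoly_ring n :: 'a mpoly ring)"
  proof (rule comm_monoidI)
    fix x y :: "'a mpoly"
    assume xy: "x \<in> carrier (mpoly_ring n)" "y \<in> carrier (mpoly_ring n)"
    have "u + v \<in> pp_terms n" if "u \<in> pp_terms n" "v \<in> pp_terms n" for u v
      using that Poly_Mapping.keys_add[of u v] by (auto simp: pp_terms_def)
    then show "x \<otimes>\<^bsub>mpoly_ring n\<^esub> y \<in> carrier (mpoly_ring n)"
      using xy Poly_Mapping.keys_mult[of x y] by (auto simp: mpoly_ring_def subset_iff)
  qed (auto simp: mpoly_ring_def pp_terms_def mult_ac)
qed (auto simp: mpoly_ring_def algebra_simps)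

definition homog_part :: "nat \<Rightarrow> nat \<Rightarrow> 'a::field mpoly set" where
  "homog_part n t = {p \<in> carrier (mpoly_ring n). \<forall>u\<in>Poly_Mapping.keys p. pp_deg u = t}"

text \<open>
  \<open>dim\<^sub>K (R/I)\<^sub>t\<close>, with \<open>K\<close> and the degree \<open>t\<close> part of \<open>R\<close> mapped to the quotient ring.
\<close>

definition hilbert_fun :: "nat \<Rightarrow> 'a::field mpoly set \<Rightarrow> nat \<Rightarrow> nat" where
  "hilbert_fun n I t =
    (let R = mpoly_ring n; Q = R Quot I
     in ring.dim Q ((\<lambda>c. I +>\<^bsub>R\<^esub> Poly_Mapping.single 0 c) ` UNIV) ((\<lambda>p. I +>\<^bsub>R\<^esub> p) ` homog_part n t))"

definition regular_sequence :: "('a, 'b) ring_scheme \<Rightarrow> nat \<Rightarrow> (nat \<Rightarrow> 'a) \<Rightarrow> bool" where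
  "regular_sequence R n f \<longleftrightarrow>
     (\<forall>i\<in>{1..n}. f i \<in> carrier R) \<and>
     (\<forall>i\<in>{1..n}. let I = Idl\<^bsub>R\<^esub> (f ` {1..<i}); Q = R Quot I in
        \<forall>x\<in>carrier Q. (I +>\<^bsub>R\<^esub> f i) \<otimes>\<^bsub>Q\<^esub> x = \<zero>\<^bsub>Q\<^esub> \<longrightarrow> x = \<zero>\<^bsub>Q\<^esub>) \<and>
     Idl\<^bsub>R\<^esub> (f ` {1..n}) \<noteq> carrier R"

definition monomial_ideal :: "nat \<Rightarrow> 'a::field mpoly set \<Rightarrow> bool" where
  "monomial_ideal n J \<longleftrightarrow> (\<exists>S \<subseteq> pp_terms n. J = Idl\<^bsub>mpoly_ring n\<^esub> (mono_of ` S))"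

text \<open>
  Divisibility of terms is the pointwise order on exponents; the order \<open>\<le>\<close> that
  \<^theory>\<open>HOL-Library.Poly_Mapping\<close> provides on \<^typ>\<open>expo\<close> is a lexicographic one.
\<close>

definition pp_dvd :: "expo \<Rightarrow> expo \<Rightarrow> bool" where
  "pp_dvd v u \<longleftrightarrow> (\<forall>i. Poly_Mapping.lookup v i \<le> Poly_Mapping.lookup u i)"

definition min_gens :: "nat \<Rightarrow> 'a::field mpoly set \<Rightarrow> expo set" where
  "min_gens n J = {u \<in> pp_terms n. mono_of u \<in> J \<and>
     (\<forall>v\<in>pp_terms n. mono_of v \<in> J \<and> pp_dvd v u \<longrightarrow> v = u)}"

text \<open>Degree reverse lexicographic order with \<open>x\<^sub>1 \<succ> \<dots> \<succ> x\<^sub>n\<close>: \<open>u \<succ> v\<close>.\<close>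

definition degrevlex_gt :: "expo \<Rightarrow> expo \<Rightarrow> bool" where
  "degrevlex_gt u v \<longleftrightarrow> pp_deg u > pp_deg v \<or>
     pp_deg u = pp_deg v \<and>
     (\<exists>i. Poly_Mapping.lookup u i < Poly_Mapping.lookup v i \<and> (\<forall>j>i. Poly_Mapping.lookup u j = Poly_Mapping.lookup v j))"

definition almost_revlex_ideal :: "nat \<Rightarrow> 'a::field mpoly set \<Rightarrow> bool" where
  "almost_revlex_ideal n J \<longleftrightarrow> monomial_ideal n J \<and>
     (\<forall>u\<in>min_gens n J. \<forall>v\<in>pp_terms n.
        pp_deg v = pp_deg u \<and> degrevlex_gt v u \<longrightarrow> mono_of v \<in> J)"

end

theory Submission
  imports Defs
begin

text \<open>
  Let \<open>D h t = max 0 (h t - h (t - 1))\<close> denote the truncated difference of a function on the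
  integers. The proof separates a combinatorial criterion, stated with \<open>D\<close>, from an arithmetic
  fact about complete intersections.

  The criterion (\<open>almost_revlex_ideal_exists\<close>): if \<open>D\<close> applied \<open>n\<close> times to \<open>h\<close> gives the
  function that is \<open>1\<close> in degree \<open>0\<close> and \<open>0\<close> elsewhere, then \<open>h\<close> is the Hilbert function of
  \<open>R/J\<close> for an almost revlex ideal \<open>J\<close>. Choose the set \<open>N t\<close> of terms of degree \<open>t\<close> outside \<open>J\<close>
  one degree at a time. A term of degree \<open>t + 1\<close> is a candidate if all its divisors of degree
  \<open>t\<close> lie in \<open>N t\<close>, and \<open>N (t + 1)\<close> consists of the \<open>h (t + 1)\<close> smallest candidates. The terms
  left out of \<open>N\<close> form a monomial ideal, a minimal generator of it is a candidate that was not
  chosen, and every greater term is then not chosen either; so the ideal is almost revlex. The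
  only question is whether there are enough candidates. The sets \<open>N t\<close> are stable: exchanging a
  variable for a later one does not leave them. Hence a candidate is the same as a term of
  \<open>N t\<close> times a variable that is not earlier than any variable in it, and the number of
  candidates in \<open>x\<^sub>1, \<dots>, x\<^sub>k\<close> is the sum over \<open>j \<le> k\<close> of the number of elements of \<open>N t\<close> in
  \<open>x\<^sub>1, \<dots>, x\<^sub>j\<close>. In the reverse lexicographic order the candidates in the first \<open>k\<close> variables
  are greater than all others, so they are removed first, and it follows by induction that
  \<open>N t\<close> has exactly \<open>D\<^sup>n\<^sup>-\<^sup>k h t\<close> elements in \<open>x\<^sub>1, \<dots>, x\<^sub>k\<close> (\<open>std_terms_invariant\<close>). Telescoping
  the definition of \<open>D\<close> shows that the number of candidates of degree \<open>t + 1\<close> is at least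
  \<open>h (t + 1) - D\<^sup>n h (t + 1) = h (t + 1)\<close>.

  The arithmetic fact: let \<open>p\<^sub>m\<close> be the Hilbert function of a complete intersection of degrees
  \<open>d\<^sub>1, \<dots>, d\<^sub>m\<close> in \<open>m\<close> variables. Counting dimensions along the regular sequence gives
  \<open>p\<^sub>m\<^sub>+\<^sub>1 t - p\<^sub>m\<^sub>+\<^sub>1 (t - 1) = p\<^sub>m t - p\<^sub>m (t - d\<^sub>m\<^sub>+\<^sub>1)\<close>, so \<open>D p\<^sub>m\<^sub>+\<^sub>1 = E p\<^sub>m\<close> where \<open>E\<close> is the truncated
  difference with step \<open>d\<^sub>m\<^sub>+\<^sub>1\<close>. For quasi-concave functions \<open>D\<close> and \<open>E\<close> commute
  (\<open>trunc_diff_commute\<close>), and \<open>E h\<close> is quasi-concave if \<open>h\<close> and \<open>D h\<close> are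
  (\<open>quasi_concave_trunc_diff\<close>). So all \<open>D\<^sup>k p\<^sub>m\<close> are quasi-concave, by induction on \<open>m\<close>, and
  \<open>D\<^sup>k\<^sup>+\<^sup>1 p\<^sub>m\<^sub>+\<^sub>1 = E D\<^sup>k p\<^sub>m\<close>; for \<open>k = m\<close> this carries \<open>D\<^sup>m p\<^sub>m\<close> to \<open>D\<^sup>m\<^sup>+\<^sup>1 p\<^sub>m\<^sub>+\<^sub>1\<close>, and the
  concentrated function is fixed by every \<open>E\<close>.
\<close>

section \<open>Iterated truncated differences\<close>

text \<open>
  Quasi-concavity is unimodality without a distinguished peak, which makes it usable pointwise.
\<close>

definition quasi_concave :: "(int \<Rightarrow> int) \<Rightarrow> bool" where
  "quasi_concave h \<longleftrightarrow> (\<forall>r s t. r \<le> s \<longrightarrow> s \<le> t \<longrightarrow> min (h r) (h t) \<le> h s)"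

definition trunc_diff :: "int \<Rightarrow> (int \<Rightarrow> int) \<Rightarrow> int \<Rightarrow> int" where
  "trunc_diff d h t = max 0 (h t - h (t - d))"

definition kron :: "int \<Rightarrow> int" where
  "kron t = (if t = 0 then 1 else 0)"

lemma quasi_concaveD: "quasi_concave h \<Longrightarrow> r \<le> s \<Longrightarrow> s \<le> t \<Longrightarrow> h s < h r \<Longrightarrow> h t \<le> h s"
  unfolding quasi_concave_def by (smt (verit))

lemma fall_between:
  fixes h :: "int \<Rightarrow> int"
  assumes "r \<le> s" "h s < h r"
  obtains i where "r < i" "i \<le> s" "h i < h (i - 1)"
proof -
  have "h r \<le> h s" if *: "\<And>i. r < i \<Longrightarrow> i \<le> s \<Longrightarrow> h (i - 1) \<le> h i"
  proof -
    have "j \<le> s \<longrightarrow> h r \<le> h j" if "r \<le> j" for j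
      using that
    proof (induction j rule: int_ge_induct)
      case (step i)
      then show ?case using *[of "i + 1"] by fastforce
    qed simp
    with assms show ?thesis by blast
  qed
  with assms that show thesis by force
qed

text \<open>
  A function that never rises after its first fall has no strict valley: a valley would have a
  fall on its left slope and a rise on its right slope.
\<close>

lemma quasi_concaveI:
  assumes "\<And>s t. h s < h (s - 1) \<Longrightarrow> s \<le> t \<Longrightarrow> h t \<le> h (t - 1)"
  shows "quasi_concave h"
  unfolding quasi_concave_def
proof (intro allI impI, rule ccontr)
  fix r s t assume rst: "r \<le> s" "s \<le> t" "\<not> min (h r) (h t) \<le> h s"
  obtain i where i: "r < i" "i \<le> s" "h i < h (i - 1)"
    by (rule fall_between[of r s h]) (use rst in auto)
  \<comment> \<open>reflect the right slope, so that a rise becomes a fall\<close>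
  obtain j where j: "-t < j" "j \<le> -s" "h (- j) < h (- (j - 1))"
    by (rule fall_between[of "-t" "-s" "\<lambda>x. h (-x)"]) (use rst in auto)
  have "h (1 - j) \<le> h (1 - j - 1)"
    using assms[OF i(3), of "1 - j"] i j by simp
  with j show False by simp
qed

text \<open>
  Once \<open>g\<close> has dropped below its value \<open>d\<close> steps earlier, the peak has been passed, and this
  comparison persists. So lagged differences of a quasi-concave function change sign only once.
\<close>

lemma quasi_concave_lag:
  assumes "quasi_concave g" "d \<ge> 0" "g s < g (s - d)" "s \<le> t"
  shows "g t \<le> g (t - d)"
proof -
  have "g t \<le> g s" using quasi_concaveD[OF assms(1), of "s - d" s t] assms by simp
  then show ?thesis using assms quasi_concaveD[OF assms(1), of "s - d" "t - d" t] by force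
qed

text \<open>
  Both sides at \<open>t\<close> truncate \<open>h t - h (t - 1) - h (t - d) + h (t - d - 1)\<close>, in different places.
  Quasi-concavity of the four values involved excludes all sign patterns in which the inner
  truncations would change the result.
\<close>

lemma trunc_diff_commute:
  assumes "quasi_concave h" "d \<ge> 1"
  shows "trunc_diff 1 (trunc_diff d h) = trunc_diff d (trunc_diff 1 h)"
proof
  fix t
  define a b c e where "a = h (t - d - 1)" and "b = h (t - d)" and "c = h (t - 1)" and "e = h t"
  have qc: "min (h r) (h u) \<le> h s" if "r \<le> s" "s \<le> u" for r s u
    using assms(1) that unfolding quasi_concave_def by blast
  have "min a c \<le> b" "min a e \<le> b" "min a e \<le> c" "min b e \<le> c"
    unfolding a_def b_def c_def e_def by (rule qc; use assms(2) in simp)+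
  moreover have "trunc_diff 1 (trunc_diff d h) t = max 0 (max 0 (e - b) - max 0 (c - a))"
    unfolding trunc_diff_def a_def b_def c_def e_def by (simp add: algebra_simps)
  moreover have "trunc_diff d (trunc_diff 1 h) t = max 0 (max 0 (e - c) - max 0 (b - a))"
    unfolding trunc_diff_def a_def b_def c_def e_def by (simp add: algebra_simps)
  ultimately show "trunc_diff 1 (trunc_diff d h) t = trunc_diff d (trunc_diff 1 h) t"
    by (simp add: max_def min_def split: if_splits)
qed

text \<open>
  By commutation, a rise of \<open>trunc_diff d h\<close> at \<open>t\<close> means that \<open>g = trunc_diff 1 h\<close> satisfies
  \<open>g t > g (t - d)\<close>. An earlier fall of \<open>trunc_diff d h\<close> rules this out: either \<open>g\<close> has already
  dropped below its lagged value, or \<open>h\<close> itself is past its peak and \<open>g\<close> vanishes from there on.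
\<close>

lemma quasi_concave_trunc_diff:
  assumes h: "quasi_concave h" and g: "quasi_concave (trunc_diff 1 h)" and d: "d \<ge> 1"
  shows "quasi_concave (trunc_diff d h)"
proof (rule quasi_concaveI)
  let ?e = "trunc_diff d h" and ?g = "trunc_diff 1 h"
  fix s t assume fall: "?e s < ?e (s - 1)" and st: "s \<le> t"
  have no_rise: "?g t \<le> ?g (t - d)"
  proof (cases "?g s < ?g (s - d)")
    case True
    with g st d show ?thesis by (intro quasi_concave_lag[of _ d s]) auto
  next
    case False
    have e: "h s - h (s - 1) < h (s - d) - h (s - d - 1)" "h (s - d - 1) < h (s - 1)"
      using fall by (auto simp: trunc_diff_def max_def algebra_simps split: if_splits)
    with False have "h (s - d) \<le> h (s - d - 1)"
      by (auto simp: trunc_diff_def max_def algebra_simps split: if_splits)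
    moreover have "h (s - d - 1) \<le> h (s - d)"
      using quasi_concaveD[OF h, of "s - d - 1" "s - d" "s - 1"] e d by force
    ultimately have "h s < h (s - 1)" using e by simp
    then have "h t \<le> h (t - 1)"
      using quasi_concave_lag[OF h, of 1 s t] st by simp
    then show ?thesis by (simp add: trunc_diff_def)
  qed
  have "trunc_diff 1 ?e t = trunc_diff d ?g t"
    by (simp add: trunc_diff_commute[OF h d])
  also have "\<dots> = 0" using no_rise by (simp add: trunc_diff_def)
  finally show "?e t \<le> ?e (t - 1)" by (simp add: trunc_diff_def)
qed

lemma trunc_diff_kron: "d \<ge> 1 \<Longrightarrow> trunc_diff d kron = kron"
  by (auto simp: trunc_diff_def kron_def)

lemma quasi_concave_kron: "quasi_concave kron"
  by (auto simp: quasi_concave_def kron_def)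

text \<open>
  The recurrence is the one between Hilbert functions of complete intersections with \<open>m\<close> and
  \<open>m + 1\<close> generators. It says that \<open>trunc_diff 1\<close> of \<open>p (Suc m)\<close> is \<open>trunc_diff (d (Suc m))\<close> of
  \<open>p m\<close>; further truncated differences are then moved past the latter. Quasi-concavity of all
  iterates has to be carried along in the induction, since both steps rely on it.
\<close>

lemma iterated_trunc_diff_recurrence:
  fixes p :: "nat \<Rightarrow> int \<Rightarrow> int" and d :: "nat \<Rightarrow> int"
  assumes p0: "p 0 = kron"
    and step: "\<And>m t. m < n \<Longrightarrow> p (Suc m) t - p (Suc m) (t - 1) = p m t - p m (t - d (Suc m))"
    and d: "\<And>m. m < n \<Longrightarrow> d (Suc m) \<ge> 1"
    and "m \<le> n"
  shows "(\<forall>k. quasi_concave ((trunc_diff 1 ^^ k) (p m))) \<and> (trunc_diff 1 ^^ m) (p m) = kron"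
  using \<open>m \<le> n\<close>
proof (induction m)
  case 0
  have "(trunc_diff 1 ^^ k) kron = kron" for k
    by (induction k) (auto simp: trunc_diff_kron)
  then show ?case by (simp add: p0 quasi_concave_kron)
next
  case (Suc m)
  let ?F = "\<lambda>m k. (trunc_diff 1 ^^ k) (p m)" and ?d = "d (Suc m)"
  have d1: "?d \<ge> 1" and st: "p (Suc m) t - p (Suc m) (t - 1) = p m t - p m (t - ?d)" for t
    using d step Suc.prems by simp_all
  have IH: "quasi_concave (?F m k)" "?F m m = kron" for k
    using Suc by auto
  have F: "?F (Suc m) (Suc k) = trunc_diff ?d (?F m k)" for k
  proof (induction k)
    case 0
    show ?case using st by (auto simp: trunc_diff_def)
  next
    case (Suc k)
    then show ?case by (simp add: trunc_diff_commute[OF IH(1) d1])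
  qed
  have "quasi_concave (p (Suc m))"
  proof (rule quasi_concaveI)
    fix s t assume *: "p (Suc m) s < p (Suc m) (s - 1)" "s \<le> t"
    then have "p m t \<le> p m (t - ?d)"
      using quasi_concave_lag[of "p m" ?d s t] IH(1)[of 0] d1 st[of s] by simp
    then show "p (Suc m) t \<le> p (Suc m) (t - 1)" using st[of t] by simp
  qed
  moreover have "quasi_concave (?F (Suc m) (Suc k))" for k
    unfolding F using quasi_concave_trunc_diff[OF IH(1) _ d1, of k] IH(1)[of "Suc k"] by simp
  ultimately have "quasi_concave (?F (Suc m) k)" for k
    by (cases k) auto
  moreover have "?F (Suc m) (Suc m) = kron"
    unfolding F IH(2) using d1 by (rule trunc_diff_kron)
  ultimately show ?case by blast
qed

text \<open>
  Hilbert functions are extended by zero to negative degrees, so that backward differences need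
  no case distinction.
\<close>

definition extend_zero :: "(nat \<Rightarrow> nat) \<Rightarrow> int \<Rightarrow> int" where
  "extend_zero h t = (if t < 0 then 0 else int (h (nat t)))"

lemma iterated_trunc_diff_Suc:
  "(trunc_diff d ^^ Suc k) h t = max 0 ((trunc_diff d ^^ k) h t - (trunc_diff d ^^ k) h (t - d))"
  by (simp add: trunc_diff_def)

lemma extend_zero_int [simp]: "extend_zero h (int t) = int (h t)"
  by (simp add: extend_zero_def)

lemma iterated_trunc_diff_neg:
  assumes "\<And>t. t < 0 \<Longrightarrow> h t = 0" "t < 0"
  shows "(trunc_diff 1 ^^ k) h t = 0"
  using assms(2)
  by (induction k arbitrary: t) (simp_all add: assms(1) iterated_trunc_diff_Suc del: funpow.simps(2))

lemma iterated_trunc_diff_0: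
  assumes "\<And>t. t < 0 \<Longrightarrow> h t = 0" "h 0 \<ge> 0"
  shows "(trunc_diff 1 ^^ k) h 0 = h 0"
  by (induction k)
    (simp_all add: assms iterated_trunc_diff_Suc iterated_trunc_diff_neg del: funpow.simps(2))

text \<open>
  Telescoping bound; it will show that there are enough candidates for standard terms.
\<close>

lemma iterated_trunc_diff_lower:
  "h t \<le> (trunc_diff 1 ^^ k) h t + (\<Sum>i<k. (trunc_diff 1 ^^ i) h (t - 1))"
proof (induction k)
  case (Suc k)
  have "(trunc_diff 1 ^^ k) h t - (trunc_diff 1 ^^ k) h (t - 1) \<le> (trunc_diff 1 ^^ Suc k) h t"
    by (simp only: iterated_trunc_diff_Suc)
  with Suc show ?case by simp
qed simp

text \<open>
  The truncations made in degree \<open>t\<close> can be replaced by a single one. This matches the way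
  in which terms in few variables are used up when the greatest candidates are removed.
\<close>

lemma iterated_trunc_diff_eq:
  assumes "\<And>t. h t \<ge> 0"
  shows "(trunc_diff 1 ^^ k) h t = max 0 (h t - (\<Sum>i<k. (trunc_diff 1 ^^ i) h (t - 1)))"
proof (induction k)
  case (Suc k)
  have "(trunc_diff 1 ^^ k) h (t - 1) \<ge> 0"
    by (cases k) (simp_all add: assms iterated_trunc_diff_Suc del: funpow.simps(2))
  then show ?case unfolding iterated_trunc_diff_Suc using Suc by simp
qed (simp add: assms)

section \<open>Counting terms\<close>

definition var :: "nat \<Rightarrow> expo" where
  "var i = Poly_Mapping.single i 1"

lemma keys_var [simp]: "Poly_Mapping.keys (var i) = {i}"
  by (simp add: var_def)

definition terms :: "nat \<Rightarrow> nat \<Rightarrow> expo set" where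
  "terms n t = {u \<in> pp_terms n. pp_deg u = t}"

lemma pp_deg_eq_sum:
  assumes "finite A" "Poly_Mapping.keys u \<subseteq> A"
  shows "pp_deg u = sum (Poly_Mapping.lookup u) A"
  unfolding pp_deg_def by (rule sum.mono_neutral_left) (use assms in \<open>auto simp: in_keys_iff\<close>)

lemma pp_deg_add: "pp_deg (u + v) = pp_deg u + pp_deg v"
proof -
  let ?A = "Poly_Mapping.keys u \<union> Poly_Mapping.keys v"
  have "pp_deg (u + v) = sum (Poly_Mapping.lookup (u + v)) ?A"
    by (rule pp_deg_eq_sum) (use Poly_Mapping.keys_add[of u v] in auto)
  also have "\<dots> = sum (Poly_Mapping.lookup u) ?A + sum (Poly_Mapping.lookup v) ?A"
    by (simp add: lookup_add sum.distrib)
  also have "\<dots> = pp_deg u + pp_deg v"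
    by (simp add: pp_deg_eq_sum[of ?A])
  finally show ?thesis .
qed

lemma pp_deg_var [simp]: "pp_deg (var i) = 1"
  by (simp add: pp_deg_def var_def)

lemma lookup_var: "Poly_Mapping.lookup (var i) j = (if j = i then 1 else 0)"
  by (simp add: var_def lookup_single when_def)

lemma pp_deg_zero [simp]: "pp_deg 0 = 0"
  by (simp add: pp_deg_def)

lemma pp_deg_eq_0_iff: "pp_deg u = 0 \<longleftrightarrow> u = 0"
  by (auto simp: pp_deg_def in_keys_iff intro!: poly_mapping_eqI)

lemma minus_add_var: "i \<in> Poly_Mapping.keys u \<Longrightarrow> u - var i + var i = u"
  by (rule poly_mapping_eqI) (auto simp: lookup_add lookup_minus lookup_var in_keys_iff)

lemma pp_terms_add: "u \<in> pp_terms n \<Longrightarrow> v \<in> pp_terms n \<Longrightarrow> u + v \<in> pp_terms n"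
  unfolding pp_terms_def using Poly_Mapping.keys_add[of u v] by blast

lemma pp_terms_minus: "u \<in> pp_terms n \<Longrightarrow> u - v \<in> pp_terms n"
  unfolding pp_terms_def by (auto simp: in_keys_iff lookup_minus subset_iff)

lemma pp_terms_mono: "k \<le> n \<Longrightarrow> pp_terms k \<subseteq> pp_terms n"
  unfolding pp_terms_def by auto

lemma var_in_pp_terms [simp]: "var i \<in> pp_terms n \<longleftrightarrow> i \<in> {1..n}"
  by (simp add: pp_terms_def)

lemma pp_terms_0: "pp_terms 0 = {0}"
  by (auto simp: pp_terms_def)

lemma zero_in_pp_terms [simp]: "0 \<in> pp_terms n"
  by (simp add: pp_terms_def)

lemma terms_deg_0: "terms n 0 = {0}"
  by (auto simp: terms_def pp_deg_eq_0_iff)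

lemma keys_plus_nat: "Poly_Mapping.keys (u + v :: expo) = Poly_Mapping.keys u \<union> Poly_Mapping.keys v"
  by (auto simp: in_keys_iff lookup_add)

lemma pp_deg_minus_var: "i \<in> Poly_Mapping.keys u \<Longrightarrow> pp_deg (u - var i) = pp_deg u - 1"
  using pp_deg_add[of "u - var i" "var i"] minus_add_var[of i u] by simp

lemma pp_deg_pos: "i \<in> Poly_Mapping.keys u \<Longrightarrow> pp_deg u > 0"
  using pp_deg_eq_0_iff[of u] by auto

lemma terms_minus_var: "u \<in> terms n (Suc t) \<Longrightarrow> i \<in> Poly_Mapping.keys u \<Longrightarrow> u - var i \<in> terms n t"
  by (simp add: terms_def pp_terms_minus pp_deg_minus_var)

lemma terms_add_var: "u \<in> terms n t \<Longrightarrow> i \<in> {1..n} \<Longrightarrow> u + var i \<in> terms n (Suc t)"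
  by (simp add: terms_def pp_terms_add pp_deg_add)

text \<open>
  The terms of degree \<open>t + 1\<close> that can still be standard when \<open>N\<close> is the set of standard terms
  of degree \<open>t\<close>.
\<close>

definition candidates :: "nat \<Rightarrow> nat \<Rightarrow> expo set \<Rightarrow> expo set" where
  "candidates n t N = {u \<in> terms n (Suc t). \<forall>i\<in>Poly_Mapping.keys u. u - var i \<in> N}"

text \<open>
  Stability of the complement: for standard terms, variables are exchanged for later ones.
\<close>

definition stable :: "nat \<Rightarrow> expo set \<Rightarrow> bool" where
  "stable n N \<longleftrightarrow> (\<forall>v\<in>N. \<forall>i\<in>Poly_Mapping.keys v. \<forall>k\<in>{i<..n}. v - var i + var k \<in> N)"

text \<open>
  A candidate that contains the last variable \<open>x\<^sub>k\<^sub>+\<^sub>1\<close> is determined by its quotient by that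
  variable. Conversely, multiplying \<open>v \<in> N\<close> by \<open>x\<^sub>k\<^sub>+\<^sub>1\<close> gives a candidate, as the remaining divisors
  \<open>v x\<^sub>k\<^sub>+\<^sub>1 / x\<^sub>i\<close> are in \<open>N\<close> by stability.
\<close>

lemma candidates_split:
  assumes "stable n N" "N \<subseteq> terms n t" "Suc k \<le> n"
  shows "candidates n t N \<inter> pp_terms (Suc k) =
    (candidates n t N \<inter> pp_terms k) \<union> (\<lambda>v. v + var (Suc k)) ` (N \<inter> pp_terms (Suc k))"
proof (intro equalityI subsetI)
  fix u assume u: "u \<in> candidates n t N \<inter> pp_terms (Suc k)"
  show "u \<in> (candidates n t N \<inter> pp_terms k) \<union> (\<lambda>v. v + var (Suc k)) ` (N \<inter> pp_terms (Suc k))"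
  proof (cases "Suc k \<in> Poly_Mapping.keys u")
    case True
    then have "u - var (Suc k) \<in> N \<inter> pp_terms (Suc k)"
      using u by (auto simp: candidates_def intro: pp_terms_minus)
    then show ?thesis using minus_add_var[OF True] by (metis UnI2 image_eqI)
  next
    case False
    have "Poly_Mapping.keys u \<subseteq> {1..k}"
    proof
      fix i assume "i \<in> Poly_Mapping.keys u"
      with u False have "i \<in> {1..Suc k}" "i \<noteq> Suc k" by (auto simp: pp_terms_def)
      then show "i \<in> {1..k}" by auto
    qed
    with u show ?thesis by (auto simp: pp_terms_def)
  qed
next
  fix u assume "u \<in> (candidates n t N \<inter> pp_terms k) \<union> (\<lambda>v. v + var (Suc k)) ` (N \<inter> pp_terms (Suc k))"
  then consider "u \<in> candidates n t N \<inter> pp_terms k" | v where "v \<in> N" "v \<in> pp_terms (Suc k)" "u = v + var (Suc k)"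
    by blast
  then show "u \<in> candidates n t N \<inter> pp_terms (Suc k)"
  proof cases
    case 1
    then show ?thesis using pp_terms_mono[of k "Suc k"] by auto
  next
    case 2
    have "u - var i \<in> N" if i: "i \<in> Poly_Mapping.keys u" for i
    proof (cases "i = Suc k")
      case True
      then show ?thesis using 2 by simp
    next
      case False
      then have iv: "i \<in> Poly_Mapping.keys v"
        using i 2 by (auto simp: keys_plus_nat split: if_splits)
      then have "i < Suc k" using 2 False by (auto simp: pp_terms_def subset_iff)
      then have "v - var i + var (Suc k) \<in> N"
        using assms iv 2 by (auto simp: stable_def)
      moreover have "v - var i + var (Suc k) = u - var i"
        by (rule poly_mapping_eqI) (use False iv in \<open>auto simp: 2 lookup_add lookup_minus lookup_var in_keys_iff\<close>)
      ultimately show ?thesis by simp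
    qed
    moreover have "u \<in> terms n (Suc t)"
      using 2 assms terms_add_var[of v n t "Suc k"] by auto
    moreover have "u \<in> pp_terms (Suc k)"
      using 2 by (simp add: pp_terms_add)
    ultimately show ?thesis by (simp add: candidates_def)
  qed
qed

lemma finite_terms: "finite (terms n t)"
proof (induction t)
  case 0
  then show ?case by (simp add: terms_deg_0)
next
  case (Suc t)
  have "terms n (Suc t) \<subseteq> (\<lambda>(v, i). v + var i) ` (terms n t \<times> {1..n})"
  proof
    fix u assume u: "u \<in> terms n (Suc t)"
    then have "u \<noteq> 0" by (auto simp: terms_def)
    then obtain i where i: "i \<in> Poly_Mapping.keys u"
      using Poly_Mapping.keys_eq_empty[of u] by blast
    then have "i \<in> {1..n}" using u by (auto simp: terms_def pp_terms_def)
    then have "(u - var i, i) \<in> terms n t \<times> {1..n}" using u i terms_minus_var by blast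
    then show "u \<in> (\<lambda>(v, i). v + var i) ` (terms n t \<times> {1..n})"
      using minus_add_var[OF i] by force
  qed
  then show ?case using Suc by (meson finite_SigmaI finite_atLeastAtMost finite_imageI finite_subset)
qed

lemma candidates_subset: "candidates n t N \<subseteq> terms n (Suc t)"
  by (auto simp: candidates_def)

lemma card_candidates_Suc:
  assumes "stable n N" "N \<subseteq> terms n t" "Suc k \<le> n"
  shows "card (candidates n t N \<inter> pp_terms (Suc k)) =
    card (candidates n t N \<inter> pp_terms k) + card (N \<inter> pp_terms (Suc k))"
proof -
  have fin: "finite N" "finite (candidates n t N)"
    using assms(2) candidates_subset finite_terms finite_subset by metis+
  have "card (candidates n t N \<inter> pp_terms (Suc k)) = card (candidates n t N \<inter> pp_terms k)
      + card ((\<lambda>v. v + var (Suc k)) ` (N \<inter> pp_terms (Suc k)))"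
    unfolding candidates_split[OF assms]
    by (rule card_Un_disjoint) (use fin in \<open>auto simp: pp_terms_def keys_plus_nat\<close>)
  also have "card ((\<lambda>v. v + var (Suc k)) ` (N \<inter> pp_terms (Suc k))) = card (N \<inter> pp_terms (Suc k))"
    by (rule card_image) (auto simp: inj_on_def)
  finally show ?thesis .
qed

lemma card_candidates:
  assumes "stable n N" "N \<subseteq> terms n t" "k \<le> n"
  shows "card (candidates n t N \<inter> pp_terms k) = (\<Sum>j=1..k. card (N \<inter> pp_terms j))"
  using assms(3)
proof (induction k)
  case 0
  have "candidates n t N \<inter> pp_terms 0 = {}"
    using candidates_subset[of n t N] by (auto simp: pp_terms_0 terms_def)
  then show ?case by simp
next
  case (Suc k)
  then show ?case using card_candidates_Suc[OF assms(1,2)] by simp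
qed

text \<open>
  The set of all terms of a fixed degree is stable, and its candidates are all terms of the next
  degree; so Pascal's rule is an instance of the count of candidates.
\<close>

lemma card_terms_Suc:
  "card (terms (Suc m) (Suc t)) = card (terms m (Suc t)) + card (terms (Suc m) t)"
proof -
  have st: "stable (Suc m) (terms (Suc m) t)"
    unfolding stable_def
  proof (intro ballI)
    fix v i k assume "v \<in> terms (Suc m) t" and i: "i \<in> Poly_Mapping.keys v" and "k \<in> {i<..Suc m}"
    then have "v - var i + var k \<in> terms (Suc m) (Suc (t - 1))"
      by (intro terms_add_var) (auto simp: terms_def pp_terms_minus pp_deg_minus_var)
    moreover have "t > 0" using pp_deg_pos[OF i] \<open>v \<in> terms (Suc m) t\<close> by (simp add: terms_def)
    ultimately show "v - var i + var k \<in> terms (Suc m) t" by simp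
  qed
  have "candidates (Suc m) t (terms (Suc m) t) = terms (Suc m) (Suc t)"
    by (auto simp: candidates_def terms_minus_var)
  moreover have "terms (Suc m) (Suc t) \<inter> pp_terms m = terms m (Suc t)"
    using pp_terms_mono[of m "Suc m"] by (auto simp: terms_def)
  moreover have "terms (Suc m) s \<inter> pp_terms (Suc m) = terms (Suc m) s" for s
    by (auto simp: terms_def)
  ultimately show ?thesis
    using card_candidates_Suc[OF st order_refl, of m] by simp
qed

section \<open>The degree reverse lexicographic order\<close>

lemma degrevlex_gt_irrefl: "\<not> degrevlex_gt u u"
  by (simp add: degrevlex_gt_def)

lemma degrevlex_gt_trans:
  assumes "degrevlex_gt u v" "degrevlex_gt v w"
  shows "degrevlex_gt u w"
proof (cases "pp_deg u = pp_deg v \<and> pp_deg v = pp_deg w")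
  case True
  obtain i where i: "Poly_Mapping.lookup u i < Poly_Mapping.lookup v i"
      "\<forall>j>i. Poly_Mapping.lookup u j = Poly_Mapping.lookup v j"
    using assms(1) True by (auto simp: degrevlex_gt_def)
  obtain k where k: "Poly_Mapping.lookup v k < Poly_Mapping.lookup w k"
      "\<forall>j>k. Poly_Mapping.lookup v j = Poly_Mapping.lookup w j"
    using assms(2) True by (auto simp: degrevlex_gt_def)
  have "Poly_Mapping.lookup u (max i k) < Poly_Mapping.lookup w (max i k)"
    using i k by (cases i k rule: linorder_cases) (auto simp: max_def)
  moreover have "\<forall>j>max i k. Poly_Mapping.lookup u j = Poly_Mapping.lookup w j"
    using i k by auto
  ultimately show ?thesis using True by (auto simp: degrevlex_gt_def)
next
  case False
  with assms show ?thesis by (auto simp: degrevlex_gt_def)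
qed

lemma degrevlex_gt_asym: "degrevlex_gt u v \<Longrightarrow> \<not> degrevlex_gt v u"
  using degrevlex_gt_trans[of u v u] degrevlex_gt_irrefl by blast

lemma degrevlex_gt_shift:
  assumes "i \<in> Poly_Mapping.keys v" "i < k"
  shows "degrevlex_gt v (v - var i + var k)"
proof -
  have "pp_deg (v - var i + var k) = pp_deg v"
    using assms pp_deg_pos[of i v] by (simp add: pp_deg_add pp_deg_minus_var)
  moreover have "Poly_Mapping.lookup v k < Poly_Mapping.lookup (v - var i + var k) k"
    using assms by (simp add: lookup_add lookup_minus lookup_var)
  moreover have "\<forall>j>k. Poly_Mapping.lookup v j = Poly_Mapping.lookup (v - var i + var k) j"
    using assms by (simp add: lookup_add lookup_minus lookup_var)
  ultimately show ?thesis by (auto simp: degrevlex_gt_def)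
qed

text \<open>
  This is the property of the reverse lexicographic order on which the count depends: among terms
  of equal degree, those in the first \<open>k\<close> variables form an upper segment.
\<close>

lemma degrevlex_gt_fewer_vars:
  assumes "u \<in> pp_terms k" "v \<notin> pp_terms k" "v \<in> pp_terms n" "pp_deg u = pp_deg v"
  shows "degrevlex_gt u v"
proof -
  let ?K = "Poly_Mapping.keys v"
  obtain i where i: "i \<in> ?K" "i > k"
    using assms(2,3) by (force simp: pp_terms_def)
  then have ne: "?K \<noteq> {}" by auto
  then have "Max ?K \<in> ?K" by (intro Max_in) auto
  moreover have "Max ?K > k" using less_le_trans[OF i(2) Max_ge[OF finite_keys i(1)]] .
  moreover have "Poly_Mapping.lookup v j = 0" if "j > Max ?K" for j
    by (metis that Max_ge finite_keys in_keys_iff leD)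
  moreover have "Poly_Mapping.lookup u j = 0" if "j > k" for j
    using assms(1) that by (auto simp: pp_terms_def in_keys_iff subset_iff)
  ultimately show ?thesis
    using assms(4) unfolding degrevlex_gt_def
    by (metis in_keys_iff less_trans not_gr_zero)
qed

text \<open>
  \<open>L\<close> consists of the \<open>m\<close> smallest elements of \<open>C\<close>.
\<close>

definition revlex_tail :: "expo set \<Rightarrow> nat \<Rightarrow> expo set \<Rightarrow> bool" where
  "revlex_tail C m L \<longleftrightarrow> L \<subseteq> C \<and> card L = m \<and> (\<forall>u\<in>L. \<forall>v\<in>C. degrevlex_gt u v \<longrightarrow> v \<in> L)"

lemma revlex_tail_exists:
  assumes "finite C" "m \<le> card C"
  shows "\<exists>L. revlex_tail C m L"
  using assms
proof (induction "card C - m" arbitrary: m)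
  case 0
  then show ?case by (intro exI[of _ C]) (auto simp: revlex_tail_def)
next
  case (Suc k)
  have "k = card C - Suc m" "Suc m \<le> card C" using Suc.hyps(2) by auto
  then obtain L where L: "revlex_tail C (Suc m) L"
    using Suc.hyps(1) Suc.prems(1) by blast
  then have "L \<noteq> {}" "finite L" using Suc.prems finite_subset by (auto simp: revlex_tail_def)
  then obtain u where u: "u \<in> L" "\<forall>v\<in>L. v \<noteq> u \<longrightarrow> \<not> degrevlex_gt v u"
    using Finite_Set.bex_min_element[of L degrevlex_gt] degrevlex_gt_asym degrevlex_gt_trans
    by (metis asymp_onI transp_onI)
  have "revlex_tail C m (L - {u})"
    using L u \<open>finite L\<close> degrevlex_gt_irrefl by (auto simp: revlex_tail_def)
  then show ?case ..
qed

text \<open>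
  Passing from \<open>C\<close> to its tail \<open>L\<close> removes the greatest elements, hence first those in the first
  \<open>k\<close> variables: either all of them are removed or nothing else is.
\<close>

lemma card_revlex_tail_Int:
  assumes C: "C \<subseteq> terms n t" and L: "revlex_tail C m L"
  shows "int (card (L \<inter> pp_terms k)) =
    max 0 (int (card (C \<inter> pp_terms k)) - (int (card C) - int m))"
proof -
  have fin: "finite C" using C finite_terms finite_subset by blast
  have LC: "L \<subseteq> C" "card L = m" using L by (auto simp: revlex_tail_def)
  then have finL: "finite L" using fin finite_subset by blast
  have cD: "int (card (C - L)) = int (card C) - int m"
    using card_Diff_subset[OF finL LC(1)] card_mono[OF fin LC(1)] LC(2) by simp
  show ?thesis
  proof (cases "L \<inter> pp_terms k = {}")
    case True
    then have "C \<inter> pp_terms k \<subseteq> C - L" by auto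
    then have "card (C \<inter> pp_terms k) \<le> card (C - L)" by (rule card_mono[rotated]) (simp add: fin)
    then show ?thesis using True cD by simp
  next
    case False
    then obtain u where u: "u \<in> L" "u \<in> pp_terms k" by auto
    have "C - L \<subseteq> pp_terms k"
    proof (rule subsetI, rule ccontr)
      fix v assume v: "v \<in> C - L" "v \<notin> pp_terms k"
      have "degrevlex_gt u v"
        by (rule degrevlex_gt_fewer_vars[OF u(2) v(2), of n])
          (use C LC u v in \<open>auto simp: terms_def subset_iff\<close>)
      then show False using L u v by (auto simp: revlex_tail_def)
    qed
    then have "C \<inter> pp_terms k = (L \<inter> pp_terms k) \<union> (C - L)" using LC by auto
    then have "card (C \<inter> pp_terms k) = card (L \<inter> pp_terms k) + card (C - L)"
      using card_Un_disjoint[of "L \<inter> pp_terms k" "C - L"] fin finL by auto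
    then show ?thesis using cD by simp
  qed
qed

text \<open>
  Exchanging a variable for a later one makes a term smaller, so it stays in the tail provided
  that it remains a candidate; the latter is inherited from the stability of \<open>N\<close>.
\<close>

lemma stable_revlex_tail_candidates:
  assumes N: "stable n N" and L: "revlex_tail (candidates n t N) m L"
  shows "stable n L"
  unfolding stable_def
proof (intro ballI)
  fix v i k assume v: "v \<in> L" and i: "i \<in> Poly_Mapping.keys v" and k: "k \<in> {i<..n}"
  let ?w = "v - var i + var k"
  have vC: "v \<in> candidates n t N" using v L by (auto simp: revlex_tail_def)
  then have i1: "i \<ge> 1" using i by (auto simp: candidates_def terms_def pp_terms_def)
  have "?w - var j \<in> N" if j: "j \<in> Poly_Mapping.keys ?w" for j
  proof (cases "j = k")
    case True
    then show ?thesis using vC i by (simp add: candidates_def)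
  next
    case False
    then have jv: "j \<in> Poly_Mapping.keys v" "i \<in> Poly_Mapping.keys (v - var j)"
      using i j by (auto simp: in_keys_iff lookup_add lookup_minus lookup_var split: if_splits)
    then have "v - var j - var i + var k \<in> N"
      using N vC k by (simp add: stable_def candidates_def)
    moreover have "v - var j - var i + var k = ?w - var j"
      by (rule poly_mapping_eqI) (use False in \<open>auto simp: lookup_add lookup_minus lookup_var\<close>)
    ultimately show ?thesis by simp
  qed
  moreover have "?w \<in> terms n (Suc t)"
    using vC i k i1 by (intro terms_add_var) (auto simp: candidates_def terms_minus_var)
  ultimately have "?w \<in> candidates n t N" by (simp add: candidates_def)
  then show "?w \<in> L"
    using L v degrevlex_gt_shift[OF i, of k] k by (auto simp: revlex_tail_def)
qed

section \<open>Building the standard terms degree by degree\<close>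

primrec std_terms :: "nat \<Rightarrow> (nat \<Rightarrow> nat) \<Rightarrow> nat \<Rightarrow> expo set" where
  "std_terms n h 0 = {0}"
| "std_terms n h (Suc t) = (SOME L. revlex_tail (candidates n t (std_terms n h t)) (h (Suc t)) L)"

declare std_terms.simps(2) [simp del]

text \<open>
  The number of standard terms in the first \<open>k\<close> variables is the truncated difference of order
  \<open>n - k\<close>. For \<open>k = 0\<close> the hypothesis on \<open>h\<close> says that these numbers vanish in positive degree,
  which is what guarantees enough candidates in every degree.
\<close>

lemma std_terms_invariant:
  assumes h0: "h 0 = 1" and hn: "(trunc_diff 1 ^^ n) (extend_zero h) = kron"
  shows "std_terms n h t \<subseteq> terms n t \<and> stable n (std_terms n h t) \<and>
    (\<forall>k\<le>n. int (card (std_terms n h t \<inter> pp_terms k)) = (trunc_diff 1 ^^ (n - k)) (extend_zero h) (int t))"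
    (is "?sub t \<and> ?st t \<and> ?cnt t")
    and "revlex_tail (candidates n t (std_terms n h t)) (h (Suc t)) (std_terms n h (Suc t))"
proof -
  let ?D = "\<lambda>k. (trunc_diff 1 ^^ k) (extend_zero h)"
  have nonneg: "extend_zero h t \<ge> 0" for t by (simp add: extend_zero_def)
  \<comment> \<open>the differences of orders \<open>n - k, \<dots>, n - 1\<close> count the candidates in the first \<open>k\<close> variables\<close>
  have counts: "int (card (candidates n t (std_terms n h t) \<inter> pp_terms k)) = (\<Sum>i\<in>{n-k..<n}. ?D i (int t))"
    if "?sub t" "?st t" "?cnt t" "k \<le> n" for t k
  proof -
    have "int (card (candidates n t (std_terms n h t) \<inter> pp_terms k)) = (\<Sum>j=1..k. ?D (n - j) (int t))"
      using that by (simp add: card_candidates)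
    also have "\<dots> = (\<Sum>i\<in>{n-k..<n}. ?D i (int t))"
      by (rule sum.reindex_bij_witness[of _ "\<lambda>i. n - i" "\<lambda>j. n - j"]) (use that in auto)
    finally show ?thesis .
  qed
  have tail: "revlex_tail (candidates n t (std_terms n h t)) (h (Suc t)) (std_terms n h (Suc t))"
    if inv: "?sub t" "?st t" "?cnt t" for t
  proof -
    \<comment> \<open>the difference of order \<open>n\<close> vanishes in degree \<open>t + 1\<close>, so the telescoping bound applies without it\<close>
    have "int (h (Suc t)) \<le> (\<Sum>i<n. ?D i (int t))"
      using iterated_trunc_diff_lower[of "extend_zero h" "int (Suc t)" n]
      using extend_zero_int[of h "Suc t"] by (simp add: hn kron_def)
    also have "\<dots> = int (card (candidates n t (std_terms n h t)))"
    proof -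
      have "candidates n t (std_terms n h t) \<inter> pp_terms n = candidates n t (std_terms n h t)"
        using candidates_subset[of n t "std_terms n h t"] by (auto simp: terms_def)
      then show ?thesis using counts[OF inv, of n] by (simp add: atLeast0LessThan)
    qed
    finally have "h (Suc t) \<le> card (candidates n t (std_terms n h t))" by simp
    moreover have "finite (candidates n t (std_terms n h t))"
      by (rule finite_subset[OF candidates_subset finite_terms])
    ultimately show ?thesis
      by (simp only: std_terms.simps(2)) (rule someI_ex[OF revlex_tail_exists])
  qed
  have inv: "?sub t \<and> ?st t \<and> ?cnt t" for t
  proof (induction t)
    case 0
    have "?D k 0 = 1" for k
      using iterated_trunc_diff_0[of "extend_zero h" k] by (simp add: extend_zero_def h0)
    then show ?case by (auto simp: terms_deg_0 stable_def)
  next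
    case (Suc t)
    let ?C = "candidates n t (std_terms n h t)" and ?L = "std_terms n h (Suc t)"
    have inv: "?sub t" "?st t" "?cnt t" using Suc by auto
    note L = tail[OF inv]
    have "?L \<subseteq> terms n (Suc t)"
      using L candidates_subset[of n t "std_terms n h t"] by (auto simp: revlex_tail_def)
    moreover have "stable n ?L"
      using stable_revlex_tail_candidates[OF inv(2) L] .
    moreover have "int (card (?L \<inter> pp_terms k)) = ?D (n - k) (int (Suc t))" if k: "k \<le> n" for k
    proof -
      have "?C \<inter> pp_terms n = ?C"
        using candidates_subset[of n t "std_terms n h t"] by (auto simp: terms_def)
      then have "int (card ?C) = (\<Sum>i\<in>{0..<n}. ?D i (int t))"
        using counts[OF inv, of n] by simp
      also have "\<dots> = (\<Sum>i\<in>{0..<n-k}. ?D i (int t)) + (\<Sum>i\<in>{n-k..<n}. ?D i (int t))"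
        by (rule sum.atLeastLessThan_concat[symmetric]) auto
      finally have "int (card (?L \<inter> pp_terms k)) = max 0 (int (h (Suc t)) - (\<Sum>i\<in>{0..<n-k}. ?D i (int t)))"
        using card_revlex_tail_Int[OF candidates_subset L, of k] counts[OF inv k] by simp
      also have "\<dots> = ?D (n - k) (int (Suc t))"
        unfolding iterated_trunc_diff_eq[OF nonneg, of "n - k"]
        using extend_zero_int[of h "Suc t"] by (simp add: atLeast0LessThan)
      finally show ?thesis .
    qed
    ultimately show ?case by blast
  qed
  show "?sub t \<and> ?st t \<and> ?cnt t" by (rule inv)
  then show "revlex_tail (candidates n t (std_terms n h t)) (h (Suc t)) (std_terms n h (Suc t))"
    using tail by blast
qed

section \<open>Hilbert functions as codimensions\<close>

definition constants :: "'a::field mpoly set" where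
  "constants = range (Poly_Mapping.single 0)"

lemma mpoly_ring_simps [simp]:
  "p \<in> carrier (mpoly_ring n) \<longleftrightarrow> Poly_Mapping.keys p \<subseteq> pp_terms n"
  "x \<otimes>\<^bsub>mpoly_ring n\<^esub> y = x * y" "x \<oplus>\<^bsub>mpoly_ring n\<^esub> y = x + y"
  "\<zero>\<^bsub>mpoly_ring n\<^esub> = 0" "\<one>\<^bsub>mpoly_ring n\<^esub> = 1"
  by (auto simp: mpoly_ring_def)

lemma a_inv_mpoly_ring:
  assumes "Poly_Mapping.keys (p :: 'a::field mpoly) \<subseteq> pp_terms n"
  shows "\<ominus>\<^bsub>mpoly_ring n\<^esub> p = - p"
proof -
  interpret R: cring "mpoly_ring n :: 'a mpoly ring" by (rule cring_mpoly_ring)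
  show ?thesis by (rule R.minus_equality) (use assms in auto)
qed

lemma subfield_consts: "subfield (constants :: 'a::field mpoly set) (mpoly_ring n)"
proof -
  interpret R: cring "mpoly_ring n :: 'a mpoly ring" by (rule cring_mpoly_ring)
  have one: "(1 :: 'a mpoly) = Poly_Mapping.single 0 1" by simp
  have sub: "constants \<subseteq> carrier (mpoly_ring n :: 'a mpoly ring)"
    by (auto simp: constants_def)
  have "subring constants (mpoly_ring n :: 'a mpoly ring)"
  proof (rule R.subringI)
    fix h :: "'a mpoly" assume "h \<in> constants"
    then show "\<ominus>\<^bsub>mpoly_ring n\<^esub> h \<in> constants"
      using sub by (auto simp: constants_def a_inv_mpoly_ring single_uminus[symmetric])
  qed (use sub in \<open>auto simp: constants_def mult_single single_add[symmetric] one simp del: single_one\<close>)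
  then have sc: "subcring constants (mpoly_ring n :: 'a mpoly ring)"
    by (rule R.subcringI')
  show ?thesis
  proof (rule R.subfieldI[OF sc])
    have inv: "Poly_Mapping.single 0 (inverse c) * Poly_Mapping.single 0 c = (1 :: 'a mpoly)" if "c \<noteq> 0" for c
      using that by (simp add: mult_single)
    show "Units (mpoly_ring n\<lparr>carrier := constants\<rparr>) = constants - {\<zero>\<^bsub>mpoly_ring n\<^esub> :: 'a mpoly}"
    proof (intro equalityI subsetI)
      fix x assume "x \<in> constants - {\<zero>\<^bsub>mpoly_ring n\<^esub> :: 'a mpoly}"
      then obtain c where c: "x = Poly_Mapping.single 0 c" and x0: "x \<noteq> 0" by (auto simp: constants_def)
      then have "c \<noteq> 0" by auto
      then have "Poly_Mapping.single 0 (inverse c) * x = 1" "x * Poly_Mapping.single 0 (inverse c) = 1"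
        using inv[of c] c by (simp_all add: mult.commute)
      then show "x \<in> Units (mpoly_ring n\<lparr>carrier := constants\<rparr>)"
        using c unfolding Units_def constants_def by auto
    next
      fix x :: "'a mpoly" assume "x \<in> Units (mpoly_ring n\<lparr>carrier := constants\<rparr>)"
      then have "x \<in> constants" "x \<noteq> 0" unfolding Units_def by auto
      then show "x \<in> constants - {\<zero>\<^bsub>mpoly_ring n\<^esub>}" by simp
    qed
  qed
qed

definition polys_on :: "expo set \<Rightarrow> 'a::field mpoly set" where
  "polys_on T = {p. Poly_Mapping.keys p \<subseteq> T}"

lemma keys_single_mult: "Poly_Mapping.keys (Poly_Mapping.single 0 c * p) \<subseteq> Poly_Mapping.keys (p :: 'a::field mpoly)"
  using Poly_Mapping.keys_mult[of "Poly_Mapping.single 0 c" p] by (auto split: if_splits)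

lemma polys_on_insert:
  assumes "u \<in> pp_terms n"
  shows "ring.line_extension (mpoly_ring n) constants (mono_of u) (polys_on T) =
    (polys_on (insert u T) :: 'a::field mpoly set)"
proof -
  interpret R: cring "mpoly_ring n :: 'a mpoly ring" by (rule cring_mpoly_ring)
  show ?thesis
  proof (intro equalityI subsetI)
    fix p :: "'a mpoly" assume "p \<in> R.line_extension constants (mono_of u) (polys_on T)"
    then obtain c v where "v \<in> polys_on T" "p = Poly_Mapping.single u c + v"
      by (auto simp: R.line_extension_mem_iff constants_def mono_of_def mult_single)
    then show "p \<in> polys_on (insert u T)"
      using Poly_Mapping.keys_add[of "Poly_Mapping.single u c" v]
      by (auto simp: polys_on_def split: if_splits)
  next
    fix p :: "'a mpoly" assume p: "p \<in> polys_on (insert u T)"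
    let ?c = "Poly_Mapping.lookup p u"
    have "p - Poly_Mapping.single u ?c \<in> polys_on T"
      using p by (auto simp: polys_on_def in_keys_iff lookup_minus lookup_single when_def subset_iff)
    moreover have "p = Poly_Mapping.single 0 ?c * mono_of u + (p - Poly_Mapping.single u ?c)"
      by (simp add: mono_of_def mult_single)
    ultimately show "p \<in> R.line_extension constants (mono_of u) (polys_on T)"
      unfolding R.line_extension_mem_iff constants_def mpoly_ring_simps by blast
  qed
qed

lemma dimension_polys_on:
  assumes "finite T" "T \<subseteq> pp_terms n"
  shows "ring.dimension (mpoly_ring n) (card T) constants (polys_on T :: 'a::field mpoly set)"
proof -
  interpret R: cring "mpoly_ring n :: 'a mpoly ring" by (rule cring_mpoly_ring)
  show ?thesis using assms
  proof (induction T rule: finite_induct)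
    case empty
    have "polys_on {} = {0 :: 'a mpoly}" by (auto simp: polys_on_def)
    then show ?case using R.zero_dim[of constants] by simp
  next
    case (insert u T)
    have "R.dimension (Suc (card T)) constants (R.line_extension constants (mono_of u) (polys_on T))"
      by (rule R.Suc_dim) (use insert in \<open>auto simp: mono_of_def polys_on_def\<close>)
    then show ?case using insert by (simp add: polys_on_insert)
  qed
qed

text \<open>
  The polynomial ring is a domain, so multiplication by \<open>f \<noteq> 0\<close> is an injective linear map.
\<close>

lemma dimension_mult:
  fixes f :: "'a::field mpoly"
  assumes "ring.dimension (mpoly_ring n) m constants E" "f \<in> carrier (mpoly_ring n)" "f \<noteq> 0"
  shows "ring.dimension (mpoly_ring n) m constants ((*) f ` E)"
proof -
  interpret R: cring "mpoly_ring n :: 'a mpoly ring" by (rule cring_mpoly_ring)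
  show ?thesis using assms(1)
  proof (induction m "constants :: 'a mpoly set" E rule: R.dimension.induct)
    case zero_dim
    show ?case using R.zero_dim[of constants] by simp
  next
    case (Suc_dim v E m)
    have "(*) f ` R.line_extension constants v E = R.line_extension constants (f * v) ((*) f ` E)"
    proof (intro equalityI subsetI)
      fix p assume "p \<in> (*) f ` R.line_extension constants v E"
      then obtain k w where "k \<in> constants" "w \<in> E" "p = f * (k * v + w)"
        by (auto simp: R.line_extension_mem_iff)
      moreover from this have "p = k * (f * v) + f * w" by (simp add: distrib_left mult.left_commute)
      ultimately show "p \<in> R.line_extension constants (f * v) ((*) f ` E)"
        unfolding R.line_extension_mem_iff mpoly_ring_simps by blast
    next
      fix p assume "p \<in> R.line_extension constants (f * v) ((*) f ` E)"
      then obtain k w where kw: "k \<in> constants" "w \<in> E" "p = k * (f * v) + f * w"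
        by (auto simp: R.line_extension_mem_iff)
      then have "p = f * (k * v + w)" by (simp add: distrib_left mult.left_commute)
      moreover have "k * v + w \<in> R.line_extension constants v E"
        using kw unfolding R.line_extension_mem_iff mpoly_ring_simps by blast
      ultimately show "p \<in> (*) f ` R.line_extension constants v E" by blast
    qed
    moreover have "f * v \<in> carrier (mpoly_ring n)"
      using R.m_closed[OF assms(2) Suc_dim(1)] by simp
    moreover have "f * v \<notin> (*) f ` E" using Suc_dim(2) assms(3) by auto
    ultimately show ?case using R.Suc_dim Suc_dim.hyps by metis
  qed
qed

lemma homog_part_eq: "homog_part n t = polys_on (terms n t)"
  by (auto simp: homog_part_def polys_on_def terms_def subset_iff)

lemma subalgebra_ideal_Int_homog:
  assumes "ideal I (mpoly_ring n :: 'a::field mpoly ring)"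
  shows "subalgebra constants (I \<inter> homog_part n t) (mpoly_ring n)"
proof -
  interpret R: cring "mpoly_ring n :: 'a mpoly ring" by (rule cring_mpoly_ring)
  interpret I: ideal I "mpoly_ring n" by (rule assms)
  have fin: "R.dimension (card (terms n t)) constants (homog_part n t)"
    unfolding homog_part_eq by (rule dimension_polys_on[OF finite_terms]) (auto simp: terms_def)
  show ?thesis
  proof (rule subalgebra.intro)
    obtain Us where "set Us \<subseteq> carrier (mpoly_ring n :: 'a mpoly ring)"
        "R.Span constants Us = homog_part n t"
      using R.exists_base[OF subfield_consts fin] by blast
    then have "subgroup (homog_part n t) (add_monoid (mpoly_ring n :: 'a mpoly ring))"
      using R.Span_is_add_subgroup[OF subfield_consts] by metis
    then show "subgroup (I \<inter> homog_part n t) (add_monoid (mpoly_ring n))"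
      by (intro R.add.subgroups_Inter_pair I.a_subgroup)
    show "subalgebra_axioms constants (I \<inter> homog_part n t) (mpoly_ring n)"
    proof
      fix k v :: "'a mpoly" assume kv: "k \<in> constants" "v \<in> I \<inter> homog_part n t"
      then have "k \<in> carrier (mpoly_ring n)" using subfieldE(3)[OF subfield_consts] by blast
      then have "k * v \<in> I" using kv I.I_l_closed[of v k] by auto
      moreover have "k * v \<in> homog_part n t"
      proof -
        obtain c where "k = Poly_Mapping.single 0 c" using kv by (auto simp: constants_def)
        then have "Poly_Mapping.keys (k * v) \<subseteq> Poly_Mapping.keys v" using keys_single_mult by simp
        then show ?thesis using kv by (auto simp: homog_part_eq polys_on_def)
      qed
      ultimately show "k \<otimes>\<^bsub>mpoly_ring n\<^esub> v \<in> I \<inter> homog_part n t" by simp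
    qed
  qed
qed

lemma (in ring) a_kernel_rcos:
  assumes "ideal I R" "E \<subseteq> carrier R"
  shows "a_kernel (R\<lparr>carrier := E\<rparr>) (R Quot I) ((+>) I) = I \<inter> E"
proof -
  have "I +> x = I \<longleftrightarrow> x \<in> I" if "x \<in> E" for x
    by (rule iffI, rule ideal.rcos_const_imp_mem[OF assms(1) subsetD[OF assms(2) that]], assumption)
      (rule a_rcos_zero[OF assms(1)])
  then show ?thesis
    unfolding a_kernel_def' FactRing_def by auto
qed

text \<open>
  Rank-nullity for the projection \<open>R \<rightarrow> R/I\<close>, restricted to the forms of degree \<open>t\<close>. It allows
  all further computations with Hilbert functions to take place inside the polynomial ring.
\<close>

lemma hilbert_fun_codim:
  assumes I: "ideal I (mpoly_ring n :: 'a::field mpoly ring)" and ne: "I \<noteq> carrier (mpoly_ring n)"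
  obtains m where "ring.dimension (mpoly_ring n) m constants (I \<inter> homog_part n t)"
    "hilbert_fun n I t + m = card (terms n t)"
proof -
  let ?R = "mpoly_ring n :: 'a mpoly ring"
  interpret R: cring ?R by (rule cring_mpoly_ring)
  interpret I: ideal I ?R by (rule assms)
  interpret h: ring_hom_ring ?R "?R Quot I" "(+>\<^bsub>?R\<^esub>) I" by (rule I.rcos_ring_hom_ring)
  have fin: "R.dimension (card (terms n t)) constants (homog_part n t)"
    unfolding homog_part_eq by (rule dimension_polys_on[OF finite_terms]) (auto simp: terms_def)
  have "R.finite_dimension constants (I \<inter> homog_part n t)"
    by (rule R.subalbegra_incl_imp_finite_dimension[OF subfield_consts R.finite_dimensionI[OF fin]
          subalgebra_ideal_Int_homog[OF I]]) auto
  then obtain m where m: "R.dimension m constants (I \<inter> homog_part n t)"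
    by (auto simp: R.finite_dimension_def)
  have one: "\<one>\<^bsub>?R Quot I\<^esub> \<noteq> \<zero>\<^bsub>?R Quot I\<^esub>"
  proof
    assume "\<one>\<^bsub>?R Quot I\<^esub> = \<zero>\<^bsub>?R Quot I\<^esub>"
    then have "I +>\<^bsub>?R\<^esub> \<one>\<^bsub>?R\<^esub> = I" by (simp add: FactRing_def)
    then have "\<one>\<^bsub>?R\<^esub> \<in> I" using I.rcos_const_imp_mem[of "\<one>\<^bsub>?R\<^esub>"] by (metis R.one_closed)
    then show False using I.one_imp_carrier ne by blast
  qed
  have carr: "homog_part n t \<subseteq> carrier ?R" by (auto simp: homog_part_def)
  note K = R.a_kernel_rcos[OF I carr]
  have ker: "R.dimension m constants (a_kernel (?R\<lparr>carrier := homog_part n t\<rparr>) (?R Quot I) ((+>\<^bsub>?R\<^esub>) I))"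
    unfolding K by (rule m)
  have "h.S.dimension (card (terms n t) - m) ((+>\<^bsub>?R\<^esub>) I ` constants) ((+>\<^bsub>?R\<^esub>) I ` homog_part n t)"
    by (rule h.rank_nullity_theorem[OF subfield_consts one fin ker])
  then have "h.S.dim ((+>\<^bsub>?R\<^esub>) I ` constants) ((+>\<^bsub>?R\<^esub>) I ` homog_part n t) = card (terms n t) - m"
    using h.S.dimI[OF h.img_is_subfield(2)[OF subfield_consts one]] by (simp add: over_def)
  then have H: "hilbert_fun n I t = card (terms n t) - m"
    by (simp add: hilbert_fun_def Let_def constants_def image_image)
  obtain Us where Us: "set Us \<subseteq> carrier ?R" "R.independent constants Us" "length Us = m"
      "R.Span constants Us = I \<inter> homog_part n t"
    using R.exists_base[OF subfield_consts m] by blast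
  then have "set Us \<subseteq> homog_part n t" using R.Span_base_incl[OF subfield_consts Us(1)] by blast
  then have "m \<le> card (terms n t)"
    using R.independent_length_le_dimension[OF subfield_consts fin Us(2)] Us(3) by blast
  with H m that show thesis by simp
qed

section \<open>Homogeneous components and regular elements\<close>

text \<open>
  The homogeneous component of degree \<open>t\<close>. An ideal is homogeneous if it is closed under
  these maps.
\<close>

lift_definition hcomp :: "nat \<Rightarrow> 'a::field mpoly \<Rightarrow> 'a mpoly" is
  "\<lambda>t p u. if pp_deg u = t then p u else 0"
  by (rule finite_subset[rotated]) auto

lemma lookup_hcomp: "Poly_Mapping.lookup (hcomp t p) u = (if pp_deg u = t then Poly_Mapping.lookup p u else 0)"
  by (simp add: hcomp.rep_eq)

lemma hcomp_add: "hcomp t (p + q) = hcomp t p + hcomp t q"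
  by (rule poly_mapping_eqI) (simp add: lookup_hcomp lookup_add)

lemma hcomp_zero [simp]: "hcomp t 0 = 0"
  by (rule poly_mapping_eqI) (simp add: lookup_hcomp)

lemma hcomp_sum: "hcomp t (\<Sum>s\<in>D. F s) = (\<Sum>s\<in>D. hcomp t (F s))"
  by (induction D rule: infinite_finite_induct) (simp_all add: hcomp_add)

lemma hcomp_of_homog:
  assumes "\<And>u. u \<in> Poly_Mapping.keys p \<Longrightarrow> pp_deg u = s"
  shows "hcomp t p = (if s = t then p else 0)"
  by (rule poly_mapping_eqI) (use assms in \<open>auto simp: lookup_hcomp in_keys_iff\<close>)

lemma keys_hcomp: "u \<in> Poly_Mapping.keys (hcomp t p) \<longleftrightarrow> u \<in> Poly_Mapping.keys p \<and> pp_deg u = t"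
  by (auto simp: in_keys_iff lookup_hcomp)

lemma sum_hcomp:
  assumes "finite D" "pp_deg ` Poly_Mapping.keys p \<subseteq> D"
  shows "(\<Sum>s\<in>D. hcomp s p) = p"
proof (rule poly_mapping_eqI)
  fix u
  have "Poly_Mapping.lookup (\<Sum>s\<in>D. hcomp s p) u = (if pp_deg u \<in> D then Poly_Mapping.lookup p u else 0)"
    using assms(1) by (simp add: lookup_sum lookup_hcomp)
  also have "\<dots> = Poly_Mapping.lookup p u"
    using assms(2) in_keys_iff[of u p] by (auto simp: image_subset_iff)
  finally show "Poly_Mapping.lookup (\<Sum>s\<in>D. hcomp s p) u = Poly_Mapping.lookup p u" .
qed

lemma hcomp_mult:
  assumes f: "\<And>u. u \<in> Poly_Mapping.keys f \<Longrightarrow> pp_deg u = d"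
  shows "hcomp t (f * g) = (if d \<le> t then f * hcomp (t - d) g else 0)"
proof -
  \<comment> \<open>\<open>t - d\<close> is included so that the component selected below has an index in the sum even if it vanishes\<close>
  let ?D = "insert (t - d) (pp_deg ` Poly_Mapping.keys g)"
  have *: "hcomp t (f * hcomp s g) = (if d + s = t then f * hcomp s g else 0)" for s
  proof (rule hcomp_of_homog)
    fix u assume "u \<in> Poly_Mapping.keys (f * hcomp s g)"
    then obtain a b where "u = a + b" "a \<in> Poly_Mapping.keys f" "b \<in> Poly_Mapping.keys (hcomp s g)"
      using Poly_Mapping.keys_mult[of f "hcomp s g"] by blast
    then show "pp_deg u = d + s" using f by (simp add: pp_deg_add keys_hcomp)
  qed
  have "f * g = (\<Sum>s\<in>?D. f * hcomp s g)"
    by (subst (1) sum_hcomp[of ?D g, symmetric]) (auto simp: sum_distrib_left)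
  then have "hcomp t (f * g) = (\<Sum>s\<in>?D. if d + s = t then f * hcomp s g else 0)"
    by (simp only: hcomp_sum *)
  also have "\<dots> = (\<Sum>s\<in>?D. if s = t - d then if d \<le> t then f * hcomp s g else 0 else 0)"
    by (rule sum.cong) auto
  also have "\<dots> = (if d \<le> t then f * hcomp (t - d) g else 0)"
    by (subst sum.delta) auto
  finally show ?thesis .
qed

lemma hcomp_homog_part: "Poly_Mapping.keys p \<subseteq> pp_terms n \<Longrightarrow> hcomp t p \<in> homog_part n t"
  by (auto simp: homog_part_def keys_hcomp)

lemma hcomp_eq_self: "p \<in> homog_part n t \<Longrightarrow> hcomp t p = p"
  using hcomp_of_homog[of p t t] by (auto simp: homog_part_def)

lemma homog_part_mult:
  fixes f g :: "'a::field mpoly"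
  assumes "f \<in> homog_part n d" "g \<in> homog_part n s"
  shows "f * g \<in> homog_part n (d + s)"
  unfolding homog_part_def
proof (intro CollectI conjI ballI)
  interpret R: cring "mpoly_ring n :: 'a mpoly ring" by (rule cring_mpoly_ring)
  have "f \<in> carrier (mpoly_ring n)" "g \<in> carrier (mpoly_ring n)"
    using assms by (auto simp: homog_part_def)
  from R.m_closed[OF this] show "f * g \<in> carrier (mpoly_ring n)" by simp
  fix u assume "u \<in> Poly_Mapping.keys (f * g)"
  then obtain a b where "u = a + b" "a \<in> Poly_Mapping.keys f" "b \<in> Poly_Mapping.keys g"
    using Poly_Mapping.keys_mult[of f g] by blast
  then show "pp_deg u = d + s" using assms by (auto simp: pp_deg_add homog_part_def)
qed

lemma (in cring) genideal_insert:
  assumes "S \<subseteq> carrier R" "a \<in> carrier R"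
  shows "Idl (insert a S) = {q \<oplus> a \<otimes> g | q g. q \<in> Idl S \<and> g \<in> carrier R}"
proof
  have S: "ideal (Idl S) R" and P: "ideal (PIdl a) R"
    using genideal_ideal[OF assms(1)] cgenideal_ideal[OF assms(2)] by auto
  have eq: "Idl S <+>\<^bsub>R\<^esub> PIdl a = {q \<oplus> a \<otimes> g | q g. q \<in> Idl S \<and> g \<in> carrier R}"
  proof -
    have "PIdl a = {a \<otimes> g | g. g \<in> carrier R}"
      unfolding cgenideal_def by (rule Collect_cong) (metis assms(2) m_comm)
    then show ?thesis unfolding set_add_def' by auto
  qed
  have "ideal (Idl S <+>\<^bsub>R\<^esub> PIdl a) R" by (rule add_ideals[OF S P])
  moreover have "insert a S \<subseteq> Idl S <+>\<^bsub>R\<^esub> PIdl a"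
  proof
    have z: "\<zero> \<in> Idl S" "\<zero> \<in> PIdl a"
      using S P by (simp_all add: additive_subgroup.zero_closed ideal.axioms(1))
    fix x assume x: "x \<in> insert a S"
    then have "x \<in> carrier R" using assms by auto
    show "x \<in> Idl S <+>\<^bsub>R\<^esub> PIdl a"
    proof (cases "x = a")
      case True
      then have "x = \<zero> \<oplus> a" using \<open>x \<in> carrier R\<close> by simp
      then show ?thesis unfolding set_add_def' using z cgenideal_self[OF assms(2)] by blast
    next
      case False
      then have "x = x \<oplus> \<zero>" "x \<in> Idl S" using x \<open>x \<in> carrier R\<close> genideal_self[OF assms(1)] by auto
      then show ?thesis unfolding set_add_def' using z by blast
    qed
  qed
  ultimately show "Idl (insert a S) \<subseteq> {q \<oplus> a \<otimes> g | q g. q \<in> Idl S \<and> g \<in> carrier R}"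
    unfolding eq by (rule genideal_minimal)
next
  have ins: "insert a S \<subseteq> carrier R" using assms by simp
  interpret J: ideal "Idl (insert a S)" R by (rule genideal_ideal[OF ins])
  have "Idl S \<subseteq> Idl (insert a S)"
    by (rule genideal_minimal[OF J.ideal_axioms]) (use genideal_self[OF ins] in auto)
  moreover have "a \<otimes> g \<in> Idl (insert a S)" if "g \<in> carrier R" for g
    by (rule J.I_r_closed) (use genideal_self[OF ins] that in auto)
  ultimately show "{q \<oplus> a \<otimes> g | q g. q \<in> Idl S \<and> g \<in> carrier R} \<subseteq> Idl (insert a S)"
    using J.a_closed by blast
qed

text \<open>
  In degree \<open>t\<close> the ideal \<open>I' = I + f R\<close> is the sum of \<open>I\<^sub>t\<close> and \<open>f R\<^sub>t\<^sub>-\<^sub>d\<close>, by homogeneity, and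
  these two spaces meet in \<open>f I\<^sub>t\<^sub>-\<^sub>d\<close>, because \<open>f\<close> is regular modulo \<open>I\<close>. The formula is the
  dimension formula for this sum.
\<close>

lemma hilbert_fun_quotient_by_regular:
  fixes f :: "'a::field mpoly"
  assumes I: "ideal I (mpoly_ring n)" and hom: "\<And>p s. p \<in> I \<Longrightarrow> hcomp s p \<in> I"
    and f: "f \<in> homog_part n d" "f \<noteq> 0"
    and reg: "\<And>g. g \<in> carrier (mpoly_ring n) \<Longrightarrow> f * g \<in> I \<Longrightarrow> g \<in> I"
    and I'_def: "I' = {q + f * g | q g. q \<in> I \<and> g \<in> carrier (mpoly_ring n)}"
    and I': "ideal I' (mpoly_ring n)" "I' \<noteq> carrier (mpoly_ring n)"
  shows "int (hilbert_fun n I' t) =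
    int (hilbert_fun n I t) - (if d \<le> t then int (hilbert_fun n I (t - d)) else 0)"
proof -
  let ?R = "mpoly_ring n :: 'a mpoly ring"
  interpret R: cring ?R by (rule cring_mpoly_ring)
  have fc: "f \<in> carrier ?R" and fk: "\<And>u. u \<in> Poly_Mapping.keys f \<Longrightarrow> pp_deg u = d"
    using f(1) by (auto simp: homog_part_def)
  have carrI: "q \<in> carrier ?R" if "q \<in> I" for q
    using that ideal.Icarr[OF I] by blast
  have zero: "(0 :: 'a mpoly) \<in> carrier ?R" by simp
  have "I \<subseteq> I'"
  proof
    fix q assume "q \<in> I"
    then have "q = q + f * 0 \<and> q \<in> I \<and> (0 :: 'a mpoly) \<in> carrier ?R" using zero by simp
    then show "q \<in> I'" unfolding I'_def by blast
  qed
  moreover have "I' \<subseteq> carrier ?R" using ideal.Icarr[OF I'(1)] by blast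
  ultimately have ne: "I \<noteq> carrier ?R" using I'(2) by blast
  obtain m' where m': "R.dimension m' constants (I' \<inter> homog_part n t)"
      "hilbert_fun n I' t + m' = card (terms n t)"
    using hilbert_fun_codim[OF I'] .
  obtain m where m: "R.dimension m constants (I \<inter> homog_part n t)"
      "hilbert_fun n I t + m = card (terms n t)"
    using hilbert_fun_codim[OF I ne] .
  have decomp: "\<exists>q g. q \<in> I \<inter> homog_part n t \<and> g \<in> carrier ?R \<and>
      p = q + (if d \<le> t then f * hcomp (t - d) g else 0)" if p: "p \<in> I' \<inter> homog_part n t" for p
  proof -
    obtain q g where qg: "q \<in> I" "g \<in> carrier ?R" "p = q + f * g"
      using p unfolding I'_def by blast
    have "p = hcomp t p" using p hcomp_eq_self[of p n t] by auto
    also have "\<dots> = hcomp t q + (if d \<le> t then f * hcomp (t - d) g else 0)"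
      by (simp only: qg(3) hcomp_add hcomp_mult[OF fk])
    finally have "p = hcomp t q + (if d \<le> t then f * hcomp (t - d) g else 0)" .
    moreover have "hcomp t q \<in> I \<inter> homog_part n t"
      using hom[OF qg(1)] hcomp_homog_part[of q n t] carrI[OF qg(1)] by simp
    ultimately show ?thesis using qg(2) by blast
  qed
  show ?thesis
  proof (cases "d \<le> t")
    case False
    then have "I' \<inter> homog_part n t = I \<inter> homog_part n t"
      using decomp \<open>I \<subseteq> I'\<close> by fastforce
    then have "m' = m" using m m' R.dimension_is_inj[OF subfield_consts] by simp
    then show ?thesis using m m' False by simp
  next
    case True
    obtain m0 where m0: "R.dimension m0 constants (I \<inter> homog_part n (t - d))"
        "hilbert_fun n I (t - d) + m0 = card (terms n (t - d))"
      using hilbert_fun_codim[OF I ne] .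
    let ?fR = "(*) f ` homog_part n (t - d)"
    have fR: "R.dimension (card (terms n (t - d))) constants ?fR"
      unfolding homog_part_eq
      by (intro dimension_mult[OF _ fc f(2)] dimension_polys_on finite_terms) (auto simp: terms_def)
    have fR_sub: "?fR \<subseteq> homog_part n t"
      using homog_part_mult[OF f(1), of _ "t - d"] True by auto
    have "(I \<inter> homog_part n t) \<inter> ?fR = (*) f ` (I \<inter> homog_part n (t - d))"
    proof (intro equalityI subsetI)
      fix p assume "p \<in> (I \<inter> homog_part n t) \<inter> ?fR"
      then obtain g where g: "g \<in> homog_part n (t - d)" "p = f * g" "f * g \<in> I" by auto
      then have "g \<in> I" using reg[of g] by (auto simp: homog_part_def)
      with g show "p \<in> (*) f ` (I \<inter> homog_part n (t - d))" by blast
    next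
      fix p assume "p \<in> (*) f ` (I \<inter> homog_part n (t - d))"
      then obtain g where g: "g \<in> I" "g \<in> homog_part n (t - d)" "p = f * g" by auto
      then have "p \<in> I" using ideal.I_l_closed[OF I g(1) fc] by simp
      with g fR_sub show "p \<in> (I \<inter> homog_part n t) \<inter> ?fR" by blast
    qed
    then have int: "R.dimension m0 constants ((I \<inter> homog_part n t) \<inter> ?fR)"
      using dimension_mult[OF m0(1) fc f(2)] by simp
    have "I' \<inter> homog_part n t = (I \<inter> homog_part n t) <+>\<^bsub>?R\<^esub> ?fR"
    proof (intro equalityI subsetI)
      fix p assume "p \<in> I' \<inter> homog_part n t"
      then obtain q g where qg: "q \<in> I \<inter> homog_part n t" "g \<in> carrier ?R" "p = q + f * hcomp (t - d) g"
        using decomp[of p] unfolding if_P[OF True] by blast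
      then have "f * hcomp (t - d) g \<in> ?fR" using hcomp_homog_part[of g n "t - d"] by (intro imageI) simp
      with qg show "p \<in> (I \<inter> homog_part n t) <+>\<^bsub>?R\<^esub> ?fR"
        unfolding set_add_def' mpoly_ring_simps by blast
    next
      fix p assume "p \<in> (I \<inter> homog_part n t) <+>\<^bsub>?R\<^esub> ?fR"
      then obtain q g where qg: "q \<in> I" "q \<in> homog_part n t" "g \<in> homog_part n (t - d)" "p = q + f * g"
        unfolding set_add_def' mpoly_ring_simps by blast
      then have "g \<in> carrier ?R" by (auto simp: homog_part_def)
      then have "p \<in> I'" unfolding I'_def using qg by blast
      moreover have "f * g \<in> homog_part n t" using qg fR_sub by blast
      then have "p \<in> homog_part n t"
        using qg Poly_Mapping.keys_add[of q "f * g"] by (fastforce simp: homog_part_eq polys_on_def)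
      ultimately show "p \<in> I' \<inter> homog_part n t" by blast
    qed
    then have "R.dimension (m + card (terms n (t - d)) - m0) constants (I' \<inter> homog_part n t)"
      using R.dimension_sum_space[OF subfield_consts m(1) fR int] by simp
    then have "m' = m + card (terms n (t - d)) - m0"
      using m'(1) R.dimension_is_inj[OF subfield_consts] by blast
    then show ?thesis using m m' m0 True by simp
  qed
qed

text \<open>
  The Hilbert function of \<open>K[x\<^sub>1, \<dots>, x\<^sub>n]\<close> modulo a regular sequence of \<open>i\<close> forms of degrees
  \<open>d 1, \<dots>, d i\<close>; numbers of variables and of forms are independent of each other, which is
  needed to compare complete intersections in different rings.
\<close>

fun ci_hilbert :: "(nat \<Rightarrow> nat) \<Rightarrow> nat \<Rightarrow> nat \<Rightarrow> int \<Rightarrow> int" where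
  "ci_hilbert d n 0 t = (if t < 0 then 0 else int (card (terms n (nat t))))"
| "ci_hilbert d n (Suc i) t = ci_hilbert d n i t - ci_hilbert d n i (t - int (d (Suc i)))"

lemma ci_hilbert_neg: "t < 0 \<Longrightarrow> ci_hilbert d n i t = 0"
  by (induction i arbitrary: t) auto

text \<open>
  Induction along the regular sequence. That each partial ideal is homogeneous is proved
  simultaneously, as the step from one ideal to the next requires it.
\<close>

lemma hilbert_fun_regular_sequence:
  fixes f :: "nat \<Rightarrow> 'a::field mpoly"
  assumes f: "\<forall>i\<in>{1..n}. f i \<in> homog_part n (d i)"
    and reg: "regular_sequence (mpoly_ring n) n f"
    and "i \<le> n"
  shows "int (hilbert_fun n (Idl\<^bsub>mpoly_ring n\<^esub> (f ` {1..i})) t) = ci_hilbert d n i (int t)"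
proof -
  let ?R = "mpoly_ring n :: 'a mpoly ring"
  interpret R: cring ?R by (rule cring_mpoly_ring)
  define I where "I i = Idl\<^bsub>?R\<^esub> (f ` {1..i})" for i
  have fc: "f ` {1..i} \<subseteq> carrier ?R" if "i \<le> n" for i
    using f that by (fastforce simp: homog_part_def)
  have idl: "ideal (I i) ?R" if "i \<le> n" for i
    unfolding I_def by (rule R.genideal_ideal[OF fc[OF that]])
  have proper: "I i \<noteq> carrier ?R" if "i \<le> n" for i
  proof -
    have "f ` {1..i} \<subseteq> I n"
      unfolding I_def by (rule subset_trans[OF _ R.genideal_self[OF fc]]) (use that in auto)
    then have "I i \<subseteq> I n"
      unfolding I_def[of i] by (rule R.genideal_minimal[OF idl[OF order_refl]])
    moreover have "I n \<subset> carrier ?R"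
      using reg ideal.Icarr[OF idl[OF order_refl]] by (auto simp: regular_sequence_def I_def)
    ultimately show ?thesis by blast
  qed
  have "(\<forall>t. int (hilbert_fun n (I i) t) = ci_hilbert d n i (int t)) \<and> (\<forall>p\<in>I i. \<forall>s. hcomp s p \<in> I i)"
    using \<open>i \<le> n\<close>
  proof (induction i)
    case 0
    have I0: "I 0 = {0}"
    proof
      have "ideal {\<zero>\<^bsub>?R\<^esub>} ?R" by (rule R.zeroideal)
      then show "I 0 \<subseteq> {0}" unfolding I_def using R.genideal_minimal[of "{\<zero>\<^bsub>?R\<^esub>}" "{}"] by simp
      show "{0} \<subseteq> I 0"
        using additive_subgroup.zero_closed[OF ideal.axioms(1)[OF idl[of 0]]] by simp
    qed
    have "int (hilbert_fun n (I 0) t) = ci_hilbert d n 0 (int t)" for t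
    proof -
      obtain m where m: "R.dimension m constants (I 0 \<inter> homog_part n t)"
          "hilbert_fun n (I 0) t + m = card (terms n t)"
        using hilbert_fun_codim[OF idl proper] by blast
      have "I 0 \<inter> homog_part n t = {\<zero>\<^bsub>?R\<^esub>}" by (auto simp: I0 homog_part_def)
      then have "m = 0"
        using m(1) R.zero_dim[of constants] R.dimension_is_inj[OF subfield_consts] by simp
      with m show ?thesis by simp
    qed
    then show ?case by (simp add: I0)
  next
    case (Suc i)
    let ?f = "f (Suc i)" and ?d = "d (Suc i)"
    have IH: "int (hilbert_fun n (I i) t) = ci_hilbert d n i (int t)" "p \<in> I i \<Longrightarrow> hcomp s p \<in> I i" for t p s
      using Suc by auto
    have i: "i \<le> n" "Suc i \<in> {1..n}" "{1..<Suc i} = {1..i}" using Suc.prems by auto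
    have fh: "?f \<in> homog_part n ?d" using f i by blast
    then have fcar: "?f \<in> carrier ?R" by (auto simp: homog_part_def)
    have fk: "\<And>u. u \<in> Poly_Mapping.keys ?f \<Longrightarrow> pp_deg u = ?d"
      using fh by (auto simp: homog_part_def)
    interpret I: ideal "I i" ?R by (rule idl[OF i(1)])
    have "\<forall>x\<in>carrier (?R Quot I i). (I i +>\<^bsub>?R\<^esub> ?f) \<otimes>\<^bsub>?R Quot I i\<^esub> x = \<zero>\<^bsub>?R Quot I i\<^esub>
        \<longrightarrow> x = \<zero>\<^bsub>?R Quot I i\<^esub>"
      using reg i unfolding regular_sequence_def Let_def I_def by metis
    then have regq: "I i +>\<^bsub>?R\<^esub> g = I i"
      if "g \<in> carrier ?R" "rcoset_mult ?R (I i) (I i +>\<^bsub>?R\<^esub> ?f) (I i +>\<^bsub>?R\<^esub> g) = I i" for g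
      using that R.a_rcosetsI[OF I.a_subset that(1)] unfolding FactRing_def by simp
    have regular: "g \<in> I i" if g: "g \<in> carrier ?R" "?f * g \<in> I i" for g
    proof -
      have "rcoset_mult ?R (I i) (I i +>\<^bsub>?R\<^esub> ?f) (I i +>\<^bsub>?R\<^esub> g) = I i +>\<^bsub>?R\<^esub> (?f \<otimes>\<^bsub>?R\<^esub> g)"
        by (rule I.rcoset_mult_add[OF fcar g(1)])
      also have "\<dots> = I i"
        by (rule R.a_rcos_zero[OF I.ideal_axioms]) (use g(2) in simp)
      finally have "I i +>\<^bsub>?R\<^esub> g = I i" by (rule regq[OF g(1)])
      then show ?thesis by (rule I.rcos_const_imp_mem[OF g(1)])
    qed
    \<comment> \<open>otherwise \<open>1\<close> would be annihilated by it, although \<open>R/I\<close> is not the zero ring\<close>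
    have "?f \<noteq> 0"
    proof
      assume "?f = 0"
      then have "?f * \<one>\<^bsub>?R\<^esub> \<in> I i" using I.zero_closed by simp
      then have "\<one>\<^bsub>?R\<^esub> \<in> I i" by (rule regular[OF R.one_closed])
      then show False using I.one_imp_carrier proper[OF i(1)] by blast
    qed
    have "f ` {1..Suc i} = insert ?f (f ` {1..i})" by (auto simp: atLeastAtMostSuc_conv)
    then have I': "I (Suc i) = {q + ?f * g | q g. q \<in> I i \<and> g \<in> carrier ?R}"
      using R.genideal_insert[OF fc[OF i(1)] fcar] unfolding I_def by simp
    have "int (hilbert_fun n (I (Suc i)) t) = ci_hilbert d n (Suc i) (int t)" for t
    proof -
      have "int (hilbert_fun n (I (Suc i)) t) =
          int (hilbert_fun n (I i) t) - (if ?d \<le> t then int (hilbert_fun n (I i) (t - ?d)) else 0)"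
        by (rule hilbert_fun_quotient_by_regular[OF idl[OF i(1)] IH(2) fh \<open>?f \<noteq> 0\<close> regular I'
              idl[OF Suc.prems] proper[OF Suc.prems]])
      then show ?thesis by (simp add: IH(1) ci_hilbert_neg of_nat_diff)
    qed
    moreover have "hcomp s p \<in> I (Suc i)" if pI: "p \<in> I (Suc i)" for p s
    proof -
      obtain q g where qg: "q \<in> I i" "g \<in> carrier ?R" "p = q + ?f * g"
        using pI unfolding I' by blast
      let ?g = "if ?d \<le> s then hcomp (s - ?d) g else 0"
      have "?g \<in> carrier ?R"
        using hcomp_homog_part[of g n] qg(2) by (auto simp: homog_part_def)
      moreover have "hcomp s p = hcomp s q + ?f * ?g"
        by (simp add: qg(3) hcomp_add hcomp_mult[OF fk])
      ultimately show ?thesis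
        using IH(2)[OF qg(1)] unfolding I' mem_Collect_eq by metis
    qed
    ultimately show ?case by blast
  qed
  then show ?thesis by (simp add: I_def)
qed

text \<open>
  The recursion in the number of forms is linear, so the difference formula is inherited from the
  case without forms, where it is Pascal's rule for terms.
\<close>

lemma ci_hilbert_diff:
  "ci_hilbert d (Suc m) i t - ci_hilbert d (Suc m) i (t - 1) = ci_hilbert d m i t"
proof (induction i arbitrary: t)
  case 0
  consider "t < 0" | "t = 0" | s where "t = int (Suc s)"
    by (metis Suc_pred linorder_not_le nonneg_int_cases of_nat_0_less_iff not_less_iff_gr_or_eq)
  then show ?case
  proof cases
    case 3
    then have "nat t = Suc s" "nat (t - 1) = s" by auto
    then show ?thesis using 3 card_terms_Suc[of m s] by simp
  qed (simp_all add: terms_deg_0)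
next
  case (Suc i)
  show ?case
    using Suc[of t] Suc[of "t - int (d (Suc i))"] by (simp add: algebra_simps)
qed

lemma ci_hilbert_0_0: "ci_hilbert d 0 0 = kron"
proof
  fix t
  have "terms 0 s = {}" if "s > 0" for s
    using that by (auto simp: terms_def pp_terms_0)
  then show "ci_hilbert d 0 0 t = kron t"
    by (cases "t > 0") (auto simp: kron_def terms_deg_0)
qed

section \<open>Monomial ideals and the existence criterion\<close>

text \<open>
  The monomial ideal generated by a set of terms that is closed under multiples consists of the
  polynomials supported on that set.
\<close>

lemma polys_on_eq_Idl:
  assumes T: "T \<subseteq> pp_terms n" and up: "\<And>u v. u \<in> T \<Longrightarrow> v \<in> pp_terms n \<Longrightarrow> u + v \<in> T"
  shows "Idl\<^bsub>mpoly_ring n\<^esub> (mono_of ` T) = (polys_on T :: 'a::field mpoly set)"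
proof -
  let ?R = "mpoly_ring n :: 'a mpoly ring"
  interpret R: cring ?R by (rule cring_mpoly_ring)
  have mono: "mono_of ` T \<subseteq> carrier ?R" using T by (auto simp: mono_of_def)
  have mult: "x * p \<in> polys_on T" if "p \<in> polys_on T" "x \<in> carrier ?R" for x p :: "'a mpoly"
    unfolding polys_on_def
  proof (intro CollectI subsetI)
    fix w assume "w \<in> Poly_Mapping.keys (x * p)"
    then obtain a b where "w = a + b" "a \<in> Poly_Mapping.keys x" "b \<in> Poly_Mapping.keys p"
      using Poly_Mapping.keys_mult[of x p] by blast
    then show "w \<in> T" using that up[of b a] by (auto simp: polys_on_def add.commute)
  qed
  have "ideal (polys_on T) ?R"
  proof (rule idealI)
    show "ring ?R" by (rule R.ring_axioms)
    show "subgroup (polys_on T) (add_monoid ?R)"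
    proof (rule R.add.subgroupI)
      show "polys_on T \<subseteq> carrier ?R" using T by (auto simp: polys_on_def)
      have "0 \<in> polys_on T" by (simp add: polys_on_def)
      then show "polys_on T \<noteq> {}" by blast
    next
      fix p :: "'a mpoly" assume "p \<in> polys_on T"
      then show "\<ominus>\<^bsub>?R\<^esub> p \<in> polys_on T"
        using T by (subst a_inv_mpoly_ring) (auto simp: polys_on_def in_keys_iff subset_iff)
    next
      fix p q :: "'a mpoly" assume "p \<in> polys_on T" "q \<in> polys_on T"
      then show "p \<oplus>\<^bsub>?R\<^esub> q \<in> polys_on T"
        using Poly_Mapping.keys_add[of p q] by (auto simp: polys_on_def)
    qed
  next
    fix p x :: "'a mpoly" assume "p \<in> polys_on T" "x \<in> carrier ?R"
    then show "x \<otimes>\<^bsub>?R\<^esub> p \<in> polys_on T" "p \<otimes>\<^bsub>?R\<^esub> x \<in> polys_on T"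
      using mult[of p x] by (simp_all add: mult.commute)
  qed
  moreover have "mono_of ` T \<subseteq> polys_on T" by (auto simp: mono_of_def polys_on_def)
  ultimately have "Idl\<^bsub>?R\<^esub> (mono_of ` T) \<subseteq> polys_on T" by (rule R.genideal_minimal)
  moreover have "polys_on T \<subseteq> Idl\<^bsub>?R\<^esub> (mono_of ` T)"
  proof
    interpret I: ideal "Idl\<^bsub>?R\<^esub> (mono_of ` T)" ?R by (rule R.genideal_ideal[OF mono])
    have fin: "polys_on F \<subseteq> Idl\<^bsub>?R\<^esub> (mono_of ` T)" if "finite F" "F \<subseteq> T" for F
      using that
    proof (induction F rule: finite_induct)
      case empty
      have "polys_on {} = {0 :: 'a mpoly}" by (auto simp: polys_on_def)
      then show ?case using I.zero_closed by simp
    next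
      case (insert u F)
      show ?case
      proof
        fix p :: "'a mpoly" assume "p \<in> polys_on (insert u F)"
        then have "p \<in> R.line_extension constants (mono_of u) (polys_on F)"
          using polys_on_insert[of u n F] insert.prems T by blast
        then obtain k q where kq: "k \<in> constants" "q \<in> polys_on F" "p = k * mono_of u + q"
          by (auto simp: R.line_extension_mem_iff)
        have "mono_of u \<in> Idl\<^bsub>?R\<^esub> (mono_of ` T)"
          using R.genideal_self[OF mono] insert.prems by blast
        moreover have "k \<in> carrier ?R" using kq(1) subfieldE(3)[OF subfield_consts] by blast
        ultimately have "k \<otimes>\<^bsub>?R\<^esub> mono_of u \<in> Idl\<^bsub>?R\<^esub> (mono_of ` T)" by (rule I.I_l_closed)
        moreover have "q \<in> Idl\<^bsub>?R\<^esub> (mono_of ` T)" using insert kq(2) by blast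
        ultimately have "k \<otimes>\<^bsub>?R\<^esub> mono_of u \<oplus>\<^bsub>?R\<^esub> q \<in> Idl\<^bsub>?R\<^esub> (mono_of ` T)" by (rule I.a_closed)
        then show "p \<in> Idl\<^bsub>?R\<^esub> (mono_of ` T)" by (simp add: kq(3))
      qed
    qed
    fix p :: "'a mpoly" assume "p \<in> polys_on T"
    then show "p \<in> Idl\<^bsub>?R\<^esub> (mono_of ` T)"
      using fin[of "Poly_Mapping.keys p"] by (auto simp: polys_on_def)
  qed
  ultimately show ?thesis by blast
qed

lemma mono_of_in_polys_on: "(mono_of u :: 'a::field mpoly) \<in> polys_on T \<longleftrightarrow> u \<in> T"
  by (simp add: mono_of_def polys_on_def)

text \<open>
  The terms that are not standard are closed under multiples, since every divisor of a standard
  term is standard. A minimal generator \<open>u\<close> is a candidate that is not in the tail, and the tail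
  would contain \<open>u\<close> if it contained a term greater than \<open>u\<close>.
\<close>

lemma almost_revlex_ideal_exists:
  assumes hn: "(trunc_diff 1 ^^ n) (extend_zero h) = kron"
  shows "\<exists>J :: 'a::field mpoly set. almost_revlex_ideal n J \<and> hilbert_fun n J = h"
proof -
  let ?R = "mpoly_ring n :: 'a mpoly ring"
  interpret R: cring ?R by (rule cring_mpoly_ring)
  have "(trunc_diff 1 ^^ n) (extend_zero h) 0 = extend_zero h 0"
    by (rule iterated_trunc_diff_0) (auto simp: extend_zero_def)
  then have h0: "h 0 = 1" by (simp add: hn kron_def extend_zero_def)
  define N where "N t = std_terms n h t" for t
  have sub: "N t \<subseteq> terms n t" and tail: "revlex_tail (candidates n t (N t)) (h (Suc t)) (N (Suc t))" for t
    using std_terms_invariant[OF h0 hn] by (auto simp: N_def)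
  have card_N: "card (N t) = h t" for t
  proof -
    have "N t \<inter> pp_terms n = N t" using sub[of t] by (auto simp: terms_def)
    moreover have "int (card (N t \<inter> pp_terms n)) = (trunc_diff 1 ^^ (n - n)) (extend_zero h) (int t)"
      using std_terms_invariant(1)[OF h0 hn, of t] unfolding N_def by blast
    ultimately show ?thesis by simp
  qed
  define T where "T = {u \<in> pp_terms n. u \<notin> N (pp_deg u)}"
  have down: "w - var i \<in> N t" if "w \<in> N (Suc t)" "i \<in> Poly_Mapping.keys w" for w i t
    using that tail[of t] by (auto simp: revlex_tail_def candidates_def)
  have up: "u + v \<in> T" if u: "u \<in> T" and v: "v \<in> pp_terms n" for u v
  proof -
    have "u + v \<notin> N (pp_deg u + s)" if "pp_deg v = s" for s
      using that
    proof (induction s arbitrary: v)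
      case 0
      then show ?case using u by (simp add: pp_deg_eq_0_iff T_def)
    next
      case (Suc s)
      then have "v \<noteq> 0" by auto
      then obtain i where i: "i \<in> Poly_Mapping.keys v"
        using Poly_Mapping.keys_eq_empty[of v] by blast
      have "u + v - var i = u + (v - var i)"
        by (rule poly_mapping_eqI) (use i in \<open>auto simp: lookup_add lookup_minus lookup_var in_keys_iff\<close>)
      moreover have "u + (v - var i) \<notin> N (pp_deg u + s)"
        using Suc.IH[of "v - var i"] Suc.prems i by (simp add: pp_deg_minus_var)
      ultimately show ?case
        using down[of "u + v" "pp_deg u + s" i] i by (auto simp: keys_plus_nat)
    qed
    then show ?thesis using u v by (simp add: T_def pp_deg_add pp_terms_add)
  qed
  have T_sub: "T \<subseteq> pp_terms n" by (auto simp: T_def)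
  define J :: "'a mpoly set" where "J = polys_on T"
  have J_Idl: "J = Idl\<^bsub>?R\<^esub> (mono_of ` T)"
    unfolding J_def by (rule polys_on_eq_Idl[OF T_sub up, symmetric])
  have mono: "mono_of u \<in> J \<longleftrightarrow> u \<in> T" for u
    by (simp add: J_def mono_of_in_polys_on)
  have zero_T: "0 \<notin> T" by (simp add: T_def N_def)
  have J_ideal: "ideal J ?R"
    unfolding J_Idl by (rule R.genideal_ideal) (use T_sub in \<open>auto simp: mono_of_def\<close>)
  have "(mono_of 0 :: 'a mpoly) \<in> carrier ?R" by (simp add: mono_of_def)
  then have J_proper: "J \<noteq> carrier ?R" using mono[of 0] zero_T by blast
  have "almost_revlex_ideal n J"
    unfolding almost_revlex_ideal_def
  proof (intro conjI ballI impI)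
    show "monomial_ideal n J" unfolding monomial_ideal_def using J_Idl T_sub by blast
    fix u v assume u: "u \<in> min_gens n J" and v: "v \<in> pp_terms n"
      and uv: "pp_deg v = pp_deg u \<and> degrevlex_gt v u"
    have uT: "u \<in> T" using u by (simp add: min_gens_def mono)
    then have "u \<noteq> 0" using zero_T by auto
    then obtain t where t: "pp_deg u = Suc t" using pp_deg_eq_0_iff[of u] by (cases "pp_deg u") auto
    have "u - var i \<in> N t" if i: "i \<in> Poly_Mapping.keys u" for i
    proof (rule ccontr)
      assume "u - var i \<notin> N t"
      then have "u - var i \<in> T"
        using uT i t by (simp add: T_def pp_terms_minus pp_deg_minus_var)
      moreover have "pp_dvd (u - var i) u" by (simp add: pp_dvd_def lookup_minus)
      ultimately have "u - var i = u" using u T_sub by (auto simp: min_gens_def mono)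
      then show False using pp_deg_minus_var[OF i] t by simp
    qed
    then have "u \<in> candidates n t (N t)" using uT t by (simp add: candidates_def terms_def T_def)
    moreover have "u \<notin> N (Suc t)" using uT t by (simp add: T_def)
    ultimately have "v \<notin> N (Suc t)" using tail[of t] uv by (auto simp: revlex_tail_def)
    then show "mono_of v \<in> J" using v uv t by (simp add: mono T_def)
  qed
  moreover have "hilbert_fun n J t = h t" for t
  proof -
    obtain m where m: "R.dimension m constants (J \<inter> homog_part n t)"
        "hilbert_fun n J t + m = card (terms n t)"
      using hilbert_fun_codim[OF J_ideal J_proper] .
    have "T \<inter> terms n t = terms n t - N t" by (auto simp: T_def terms_def)
    then have "J \<inter> homog_part n t = polys_on (terms n t - N t)"
      by (auto simp: J_def homog_part_eq polys_on_def)
    moreover have "R.dimension (card (terms n t - N t)) constants (polys_on (terms n t - N t))"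
      by (rule dimension_polys_on[OF finite_Diff[OF finite_terms]]) (auto simp: terms_def)
    ultimately have "m = card (terms n t - N t)"
      using m(1) R.dimension_is_inj[OF subfield_consts] by simp
    also have "\<dots> = card (terms n t) - h t"
      using card_Diff_subset[OF finite_subset[OF sub finite_terms] sub] by (simp add: card_N)
    finally show ?thesis
      using m(2) card_mono[OF finite_terms sub, of t] by (simp add: card_N)
  qed
  ultimately show ?thesis by blast
qed

section \<open>Complete intersections\<close>

theorem theorem4p1:
  fixes n :: nat and d :: "nat \<Rightarrow> nat" and f :: "nat \<Rightarrow> 'k::field mpoly"
  assumes "n \<ge> 1"
    and "\<forall>i\<in>{1..n}. 2 \<le> d i"
    and "mono_on {1..n} d"
    and "\<forall>i\<in>{1..n}. f i \<in> homog_part n (d i)"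
    and "regular_sequence (mpoly_ring n) n f"
  shows "\<exists>J :: 'k mpoly set. almost_revlex_ideal n J \<and>
     hilbert_fun n J = hilbert_fun n (Idl\<^bsub>mpoly_ring n\<^esub> (f ` {1..n}))"
proof -
  let ?h = "hilbert_fun n (Idl\<^bsub>mpoly_ring n\<^esub> (f ` {1..n}))"
  have "extend_zero ?h = ci_hilbert d n n"
  proof
    fix t
    show "extend_zero ?h t = ci_hilbert d n n t"
      using hilbert_fun_regular_sequence[OF assms(4,5) order_refl, of "nat t"]
      by (cases "t < 0") (auto simp: extend_zero_def ci_hilbert_neg)
  qed
  moreover have "(trunc_diff 1 ^^ n) (ci_hilbert d n n) = kron"
  proof -
    have "ci_hilbert d (Suc m) (Suc m) t - ci_hilbert d (Suc m) (Suc m) (t - 1) =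
        ci_hilbert d m m t - ci_hilbert d m m (t - int (d (Suc m)))" for m t
      using ci_hilbert_diff[of d m "Suc m" t] by simp
    moreover have "1 \<le> int (d (Suc m))" if "m < n" for m
    proof -
      have "2 \<le> d (Suc m)" using assms(2) that by simp
      then show ?thesis by simp
    qed
    ultimately show ?thesis
      using iterated_trunc_diff_recurrence[of "\<lambda>m. ci_hilbert d m m" n "\<lambda>i. int (d i)" n] ci_hilbert_0_0
      by simp
  qed
  ultimately show ?thesis using almost_revlex_ideal_exists by metis
qed

end
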